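(* Let $p_1,p_2\in\mathbb{N}$ and let $L$ be the partial difference operator of the second order on $\ell^2(\mathbb{Z}^2)$ given by $$(Lu)_{i,k}=a_{i-1,k}u_{i-1,k}+a_{i,k}u_{i+1,k}+b_{i,k-1}u_{i,k-1}+b_{i,k}u_{i,k+1}+c_{i,k}u_{i,k},\qquad i,k\in\mathbb{Z},$$ with real $(p_1,p_2)$-periodic coefficients $\{a_{i,k}\},\{b_{i,k}\},\{c_{i,k}\}$. Then the Lebesgue measure $|\sigma(L)|$ of the spectrum of $L$ satisfies $$\frac14\,|\sigma(L)|\le \min_{n}\sum_{j=1}^{p_1}|b_{j,n}|+\min_{m}\sum_{k=1}^{p_2}|a_{m,k}|,$$ where the minima are over $n\in\mathbb{Z}$ and $m\in\mathbb{Z}$ respectively. In particular, for the $2D$ $(p_1,p_2)$-periodic discrete Schr\"odinger operator $H$ on $\ell^2(\mathbb{Z}^2)$, $$(Hu)_{i,k}=u_{i-1,k}+u_{i+1,k}+u_{i,k-1}+u_{i,k+1}+c_{i,k}u_{i,k},$$ with real $(p_1,p_2)$-periodic potential $\{c_{i,k}\}$, one has $|\sigma(H)|\le 4(p_1+p_2)$.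
   Context: A double sequence $\{w_{i,k}\}_{i,k\in\mathbb{Z}}$ is $(p_1,p_2)$-periodic if $w_{i+k_1p_1,\,k+k_2p_2}=w_{i,k}$ for all $i,k,k_1,k_2\in\mathbb{Z}$. Under these assumptions $L$ and $H$ are bounded self-adjoint operators on $\ell^2(\mathbb{Z}^2)$; $\sigma(\cdot)$ denotes the spectrum and $|\cdot|$ the Lebesgue measure of subsets of $\mathbb{R}$. *)

theory Defs
  imports "HOL-Analysis.Analysis"
begin

definition ell2 :: "('i \<Rightarrow> complex) set" where
  "ell2 = {u. (\<lambda>x. (cmod (u x))\<^sup>2) summable_on UNIV}"

definition ell2_norm :: "('i \<Rightarrow> complex) \<Rightarrow> real" where
  "ell2_norm u = sqrt (infsum (\<lambda>x. (cmod (u x))\<^sup>2) UNIV)"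

text \<open>
  Operators on the Hilbert space of square-summable families are represented by maps on all
  families; only their restriction to \<open>ell2\<close> matters. A point \<open>z\<close> is in the resolvent set if
  \<open>T - z\<close> maps \<open>ell2\<close> bijectively onto itself and the inverse map is bounded; for linear \<open>T\<close>
  the inverse is automatically linear.
\<close>

definition shifted_op ::
  "(('i \<Rightarrow> complex) \<Rightarrow> ('i \<Rightarrow> complex)) \<Rightarrow> complex \<Rightarrow> ('i \<Rightarrow> complex) \<Rightarrow> ('i \<Rightarrow> complex)" where
  "shifted_op T z u = (\<lambda>x. T u x - z * u x)"

definition resolvent_set :: "(('i \<Rightarrow> complex) \<Rightarrow> ('i \<Rightarrow> complex)) \<Rightarrow> complex set" where
  "resolvent_set T = {z. bij_betw (shifted_op T z) ell2 ell2 \<and>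
     (\<exists>C. \<forall>v\<in>ell2. ell2_norm (inv_into ell2 (shifted_op T z) v) \<le> C * ell2_norm v)}"

definition spectrum :: "(('i \<Rightarrow> complex) \<Rightarrow> ('i \<Rightarrow> complex)) \<Rightarrow> complex set" where
  "spectrum T = - resolvent_set T"

text \<open>
  The spectrum as a subset of the real line. The operators below are bounded and self-adjoint, so
  their spectrum is real and nothing is lost.
\<close>

definition real_spectrum :: "(('i \<Rightarrow> complex) \<Rightarrow> ('i \<Rightarrow> complex)) \<Rightarrow> real set" where
  "real_spectrum T = complex_of_real -` spectrum T"

definition doubly_periodic :: "nat \<Rightarrow> nat \<Rightarrow> (int \<Rightarrow> int \<Rightarrow> 'a) \<Rightarrow> bool" where
  "doubly_periodic p1 p2 w \<longleftrightarrow>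
     (\<forall>i k k1 k2. w (i + k1 * int p1) (k + k2 * int p2) = w i k)"

definition difference_op ::
  "(int \<Rightarrow> int \<Rightarrow> real) \<Rightarrow> (int \<Rightarrow> int \<Rightarrow> real) \<Rightarrow> (int \<Rightarrow> int \<Rightarrow> real)
    \<Rightarrow> (int \<times> int \<Rightarrow> complex) \<Rightarrow> (int \<times> int \<Rightarrow> complex)" where
  "difference_op a b c u = (\<lambda>(i, k).
       of_real (a (i - 1) k) * u (i - 1, k) + of_real (a i k) * u (i + 1, k)
     + of_real (b i (k - 1)) * u (i, k - 1) + of_real (b i k) * u (i, k + 1)
     + of_real (c i k) * u (i, k))"

definition schroedinger_op ::
  "(int \<Rightarrow> int \<Rightarrow> real) \<Rightarrow> (int \<times> int \<Rightarrow> complex) \<Rightarrow> (int \<times> int \<Rightarrow> complex)" where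
  "schroedinger_op c u = (\<lambda>(i, k).
       u (i - 1, k) + u (i + 1, k) + u (i, k - 1) + u (i, k + 1) + of_real (c i k) * u (i, k))"

text \<open>
  By periodicity, a quantity that depends on one row or one column of the coefficients takes only
  finitely many values, so that \<open>Min\<close> applied to the set of its values is a genuine minimum.
\<close>

lemma finite_range_periodic:
  fixes f :: "int \<Rightarrow> 'a"
  assumes "p > 0" and "\<And>i m. f (i + m * int p) = f i"
  shows "finite (range f)"
proof -
  have "f i = f (i mod int p)" for i
    using assms(2)[of "i mod int p" "i div int p"] by (simp add: add.commute)
  moreover have "i mod int p \<in> {0..<int p}" for i
    using assms(1) by simp
  ultimately have "range f \<subseteq> f ` {0..<int p}"
    by blast
  then show ?thesis
    by (rule finite_subset) simp
qed

lemma finite_range_row_sums: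
  fixes b :: "int \<Rightarrow> int \<Rightarrow> real"
  assumes "p2 > 0" and "doubly_periodic p1 p2 b"
  shows "finite (range (\<lambda>n. \<Sum>j = 1..int p1. \<bar>b j n\<bar>))"
proof (rule finite_range_periodic[OF assms(1)])
  have "b j (n + m * int p2) = b j n" for j n m
    using assms(2)[unfolded doubly_periodic_def, rule_format, of j 0 n m] by simp
  then show "(\<Sum>j = 1..int p1. \<bar>b j (n + m * int p2)\<bar>) = (\<Sum>j = 1..int p1. \<bar>b j n\<bar>)" for n m
    by simp
qed

lemma finite_range_column_sums:
  fixes a :: "int \<Rightarrow> int \<Rightarrow> real"
  assumes "p1 > 0" and "doubly_periodic p1 p2 a"
  shows "finite (range (\<lambda>m. \<Sum>k = 1..int p2. \<bar>a m k\<bar>))"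
proof (rule finite_range_periodic[OF assms(1)])
  have "a (m + l * int p1) k = a m k" for m l k
    using assms(2)[unfolded doubly_periodic_def, rule_format, of m l k 0] by simp
  then show "(\<Sum>k = 1..int p2. \<bar>a (m + l * int p1) k\<bar>) = (\<Sum>k = 1..int p2. \<bar>a m k\<bar>)" for m l
    by simp
qed

end

theory Submission
  imports Defs
begin

text \<open>
  The idea is to sandwich the operator \<open>L\<close> between two operators that decouple into finite matrices,
  without passing to its Floquet representation.
  
  Fix a column \<open>m\<close> and a row \<open>n\<close> and delete all edges that leave a column congruent to \<open>m\<close>
  to the right or a row congruent to \<open>n\<close> upwards. The lattice falls apart into translates of one
  period cell. An edge of weight \<open>w\<close> contributes \<open>2 Re (w u\<^sub>x cnj u\<^sub>y)\<close> to the quadratic form, which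
  lies between \<open>\<plusminus> \<bar>w\<bar> (\<bar>u\<^sub>x\<bar>\<^sup>2 + \<bar>u\<^sub>y\<bar>\<^sup>2)\<close>. So if the deleted weights are subtracted from, or added to,
  the diagonal at both end points of the edge, one gets block diagonal operators below and
  above \<open>L\<close>, with real symmetric blocks \<open>A \<le> B\<close>
  (\<open>edge_form_nonneg\<close>, \<open>periodic_difference_op_spectrum_bound\<close>). The deleted edges of one
  period have total weight \<open>\<Sum>\<bar>a\<^sub>m\<^sub>,\<^sub>k\<bar> + \<Sum>\<bar>b\<^sub>j\<^sub>,\<^sub>n\<bar>\<close>. Each is counted at two ends and with both
  signs, so \<open>tr B - tr A\<close> is four times this number, and \<open>m\<close> and \<open>n\<close> may be chosen to minimize it.
  
  Let \<open>\<mu>\<^sub>j \<le> \<nu>\<^sub>j\<close> be the sorted eigenvalues of \<open>A\<close> and \<open>B\<close>. The intervals \<open>[\<mu>\<^sub>j, \<nu>\<^sub>j]\<close> have total length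
  \<open>tr B - tr A\<close>, so it remains to see that they cover the spectrum. If \<open>l\<close> is in none of them, then
  the cell space splits into a subspace where \<open>B < l\<close> and a complement where \<open>A > l\<close>
  (\<open>eigenvalue_intervals_and_gap_splitting\<close>). Repeated in every cell, this splits the Hilbert space into two
  parts on which \<open>L - l\<close> is negative and positive definite, and a symmetric operator with such a
  splitting is invertible (\<open>boundedly_invertible_if_definite_splitting\<close>, a consequence of the Lax-Milgram lemma).
\<close>

section \<open>Quadratic forms in finitely many variables\<close>

text \<open>
  Gaussian elimination of one equation and one unknown at a time. This single dimension count
  replaces all uses of bases and dimensions below.
\<close>

lemma underdetermined_system_nontrivial_solution:
  fixes M :: "'j \<Rightarrow> 'i \<Rightarrow> real"
  assumes "finite J" "finite I" "card J < card I"
  shows "\<exists>x. (\<exists>i\<in>I. x i \<noteq> 0) \<and> (\<forall>j\<in>J. (\<Sum>i\<in>I. M j i * x i) = 0)"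
  using assms
proof (induction J arbitrary: I M rule: finite_induct)
  case empty
  then have "I \<noteq> {}" by auto
  then show ?case by (intro exI[of _ "\<lambda>_. 1"]) auto
next
  case (insert j J)
  show ?case
  proof (cases "\<forall>i\<in>I. M j i = 0")
    case True
    have "card J < card I" using insert by simp
    from insert.IH[OF insert.prems(1) this] True show ?thesis by auto
  next
    case False
    then obtain p where p: "p \<in> I" "M j p \<noteq> 0" by auto
    \<comment> \<open>the pivot equation \<open>j\<close> is solved for the unknown \<open>p\<close>\<close>
    define M' where "M' l i = M l i - M l p * M j i / M j p" for l i
    have "card J < card (I - {p})" using insert p by simp
    then obtain x where x: "\<exists>i\<in>I-{p}. x i \<noteq> 0"
        "\<forall>l\<in>J. (\<Sum>i\<in>I-{p}. M' l i * x i) = 0"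
      using insert.IH[of "I - {p}" M'] insert.prems(1) by auto
    define y where "y = x(p := - (\<Sum>i\<in>I-{p}. M j i * x i) / M j p)"
    have split: "(\<Sum>i\<in>I. M l i * y i) = M l p * y p + (\<Sum>i\<in>I-{p}. M l i * x i)" for l
      using p insert.prems(1) by (subst sum.remove[of _ p]) (auto simp: y_def)
    have "(\<Sum>i\<in>I. M j i * y i) = 0"
      unfolding split using p by (simp add: y_def)
    moreover have "(\<Sum>i\<in>I. M l i * y i) = 0" if "l \<in> J" for l
    proof -
      have M': "M' l i * x i = M l i * x i - M l p / M j p * (M j i * x i)" for i
        by (simp add: M'_def left_diff_distrib)
      have "0 = (\<Sum>i\<in>I-{p}. M' l i * x i)" using x(2) that by simp
      also have "\<dots> = (\<Sum>i\<in>I-{p}. M l i * x i) - M l p / M j p * (\<Sum>i\<in>I-{p}. M j i * x i)"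
        unfolding M' sum_subtractf sum_distrib_left ..
      also have "\<dots> = (\<Sum>i\<in>I. M l i * y i)"
        unfolding split by (simp add: y_def)
      finally show ?thesis by simp
    qed
    moreover have "\<exists>i\<in>I. y i \<noteq> 0" using x(1) by (auto simp: y_def)
    ultimately show ?thesis by auto
  qed
qed

text \<open>
  Vectors are functions on the lattice of which only the restriction to a finite set \<open>I\<close> counts:
  the dimension, the number of sites in a period cell, is a variable of the problem and cannot be
  a type.
\<close>

definition dot_on :: "'i set \<Rightarrow> ('i \<Rightarrow> real) \<Rightarrow> ('i \<Rightarrow> real) \<Rightarrow> real" where
  "dot_on I u v = (\<Sum>x\<in>I. u x * v x)"

definition form_on :: "'i set \<Rightarrow> ('i \<Rightarrow> 'i \<Rightarrow> real) \<Rightarrow> ('i \<Rightarrow> real) \<Rightarrow> ('i \<Rightarrow> real) \<Rightarrow> real" where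
  "form_on I A u v = (\<Sum>x\<in>I. \<Sum>y\<in>I. A x y * u x * v y)"

lemma dot_on_commute: "dot_on I u v = dot_on I v u"
  by (simp add: dot_on_def mult.commute)

lemma dot_on_add_left: "dot_on I (\<lambda>x. u x + v x) w = dot_on I u w + dot_on I v w"
  by (simp add: dot_on_def distrib_right sum.distrib)

lemma dot_on_add_right: "dot_on I w (\<lambda>x. u x + v x) = dot_on I w u + dot_on I w v"
  by (simp add: dot_on_def distrib_left sum.distrib)

lemma dot_on_diff_right: "dot_on I w (\<lambda>x. u x - v x) = dot_on I w u - dot_on I w v"
  by (simp add: dot_on_def right_diff_distrib sum_subtractf)

lemma dot_on_scale_left: "dot_on I (\<lambda>x. r * u x) w = r * dot_on I u w"
  by (simp add: dot_on_def sum_distrib_left mult_ac)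

lemma dot_on_scale_right: "dot_on I w (\<lambda>x. r * u x) = r * dot_on I w u"
  by (simp add: dot_on_def sum_distrib_left mult_ac)

lemma dot_on_sum_right: "dot_on I w (\<lambda>x. \<Sum>j\<in>J. c j * e j x) = (\<Sum>j\<in>J. c j * dot_on I w (e j))"
  unfolding dot_on_def sum_distrib_left by (subst sum.swap) (simp add: mult_ac)

lemma dot_on_sum_left: "dot_on I (\<lambda>x. \<Sum>j\<in>J. c j * e j x) w = (\<Sum>j\<in>J. c j * dot_on I (e j) w)"
  by (simp add: dot_on_sum_right dot_on_commute[of I _ w])

lemma dot_on_ge_zero: "dot_on I u u \<ge> 0"
  by (simp add: dot_on_def sum_nonneg)

lemma dot_on_eq_zero: "finite I \<Longrightarrow> dot_on I u u = 0 \<longleftrightarrow> (\<forall>x\<in>I. u x = 0)"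
  by (auto simp: dot_on_def sum_nonneg_eq_0_iff)

lemma form_on_add_left: "form_on I A (\<lambda>x. u x + v x) w = form_on I A u w + form_on I A v w"
  by (simp add: form_on_def algebra_simps sum.distrib)

lemma form_on_add_right: "form_on I A w (\<lambda>x. u x + v x) = form_on I A w u + form_on I A w v"
  by (simp add: form_on_def algebra_simps sum.distrib)

lemma form_on_scale_left: "form_on I A (\<lambda>x. r * u x) w = r * form_on I A u w"
  by (simp add: form_on_def sum_distrib_left mult_ac)

lemma form_on_scale_right: "form_on I A w (\<lambda>x. r * u x) = r * form_on I A w u"
  by (simp add: form_on_def sum_distrib_left mult_ac)

lemma form_on_eq_dot_on: "form_on I A u w = dot_on I (\<lambda>y. \<Sum>x\<in>I. A x y * u x) w"
  unfolding form_on_def dot_on_def sum_distrib_right by (rule sum.swap)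

lemma form_on_sum_right:
  "form_on I A w (\<lambda>x. \<Sum>j\<in>J. c j * e j x) = (\<Sum>j\<in>J. c j * form_on I A w (e j))"
  by (simp add: form_on_eq_dot_on dot_on_sum_right)

lemma form_on_commute:
  assumes "\<forall>x\<in>I. \<forall>y\<in>I. A x y = A y x"
  shows "form_on I A u v = form_on I A v u"
  unfolding form_on_def using assms
  by (subst sum.swap) (auto intro!: sum.cong simp: mult_ac)

lemma form_on_cong:
  "(\<And>x. x \<in> I \<Longrightarrow> u x = u' x) \<Longrightarrow> (\<And>x. x \<in> I \<Longrightarrow> v x = v' x) \<Longrightarrow> form_on I A u v = form_on I A u' v'"
  by (simp add: form_on_def)

lemma dot_on_cong:
  "(\<And>x. x \<in> I \<Longrightarrow> u x = u' x) \<Longrightarrow> (\<And>x. x \<in> I \<Longrightarrow> v x = v' x) \<Longrightarrow> dot_on I u v = dot_on I u' v'"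
  by (simp add: dot_on_def)

text \<open>
  The unit sphere of the orthogonal complement of \<open>k < card I\<close> vectors is nonempty and compact, so
  the form attains its minimum on it; homogeneity turns this into the inequality for all vectors of
  the complement.
\<close>

lemma form_on_minimizer_exists:
  fixes e :: "nat \<Rightarrow> 'i \<Rightarrow> real"
  assumes "finite I" "k < card I"
  shows "\<exists>v. dot_on I v v = 1 \<and> (\<forall>j<k. dot_on I (e j) v = 0) \<and>
     (\<forall>h. (\<forall>j<k. dot_on I (e j) h = 0) \<longrightarrow> form_on I A v v * dot_on I h h \<le> form_on I A h h)"
proof -
  define B where "B = (\<Pi>\<^sub>E x\<in>UNIV. if x \<in> I then {-1..1::real} else {0})"
  define K where "K = B \<inter> {v. dot_on I v v = 1 \<and> (\<forall>j<k. dot_on I (e j) v = 0)}"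
  have "compactin (product_topology (\<lambda>_. euclidean) UNIV) B"
    unfolding B_def compactin_PiE by auto
  then have "compact B" by (simp add: euclidean_product_topology)
  moreover have "closed {v. dot_on I v v = 1 \<and> (\<forall>j<k. dot_on I (e j) v = 0)}"
    unfolding dot_on_def
    by (intro closed_Collect_conj closed_Collect_all closed_Collect_imp closed_Collect_eq
        continuous_intros continuous_on_product_coordinates) auto
  ultimately have "compact K" unfolding K_def by (rule compact_Int_closed)
  \<comment> \<open>vectors are cut off outside \<open>I\<close> to land in the compact box\<close>
  define cut where "cut u x = (if x \<in> I then u x else 0)" for u :: "'i \<Rightarrow> real" and x
  have dot_cut: "dot_on I (cut u) (cut v) = dot_on I u v" "dot_on I u (cut v) = dot_on I u v" "dot_on I (cut u) v = dot_on I u v" for u v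
    by (auto intro!: dot_on_cong simp: cut_def)
  have normalized: "cut (\<lambda>x. h x / sqrt (dot_on I h h)) \<in> K"
    if orth: "\<forall>j<k. dot_on I (e j) h = 0" and pos: "dot_on I h h > 0" for h
  proof -
    define r where "r = 1 / sqrt (dot_on I h h)"
    have r: "r * r * dot_on I h h = 1"
      using pos by (simp add: r_def)
    have eq: "(\<lambda>x. h x / sqrt (dot_on I h h)) = (\<lambda>x. r * h x)"
      by (simp add: r_def)
    have one: "dot_on I (\<lambda>x. r * h x) (\<lambda>x. r * h x) = 1"
      using r by (simp add: dot_on_scale_left dot_on_scale_right)
    have "\<bar>r * h x\<bar> \<le> 1" if "x \<in> I" for x
    proof -
      have "(r * h x)\<^sup>2 \<le> dot_on I (\<lambda>x. r * h x) (\<lambda>x. r * h x)"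
        unfolding dot_on_def power2_eq_square using assms(1) that
        by (intro member_le_sum) auto
      then show ?thesis unfolding one by (simp add: abs_le_square_iff[of _ 1, simplified])
    qed
    then have "cut (\<lambda>x. r * h x) \<in> B"
      by (auto simp: B_def cut_def abs_le_iff minus_le_iff)
    moreover have "dot_on I (e j) (\<lambda>x. r * h x) = 0" if "j < k" for j
      using orth that by (simp add: dot_on_scale_right)
    ultimately show ?thesis unfolding eq K_def using one by (simp add: dot_cut)
  qed
  \<comment> \<open>fewer conditions than dimensions leave a nonzero vector\<close>
  have "\<exists>u. (\<exists>i\<in>I. u i \<noteq> 0) \<and> (\<forall>j\<in>{..<k}. (\<Sum>i\<in>I. e j i * u i) = 0)"
    by (rule underdetermined_system_nontrivial_solution) (use assms in auto)
  then obtain u where u: "\<exists>i\<in>I. u i \<noteq> 0" "\<forall>j<k. dot_on I (e j) u = 0"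
    by (auto simp: dot_on_def)
  then have "dot_on I u u > 0"
    using dot_on_eq_zero[OF assms(1), of u] dot_on_ge_zero[of I u] by force
  then have "K \<noteq> {}" using normalized[OF u(2)] by auto
  moreover have "continuous_on K (\<lambda>v. form_on I A v v)"
    unfolding form_on_def
    by (intro continuous_intros continuous_on_product_coordinates continuous_on_subset[OF _ subset_UNIV])
  ultimately obtain v where v: "v \<in> K" "\<And>w. w \<in> K \<Longrightarrow> form_on I A v v \<le> form_on I A w w"
    using continuous_attains_inf[OF \<open>compact K\<close>] by blast
  have "form_on I A v v * dot_on I h h \<le> form_on I A h h"
    if h: "\<forall>j<k. dot_on I (e j) h = 0" for h
  proof (cases "dot_on I h h = 0")
    case True
    then have "form_on I A h h = 0"
      using dot_on_eq_zero[OF assms(1), of h] by (simp add: form_on_def)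
    then show ?thesis using True by simp
  next
    case False
    then have pos: "dot_on I h h > 0" using dot_on_ge_zero[of I h] by simp
    define r where "r = 1 / sqrt (dot_on I h h)"
    have "form_on I A v v \<le> form_on I A (cut (\<lambda>x. h x / sqrt (dot_on I h h))) (cut (\<lambda>x. h x / sqrt (dot_on I h h)))"
      by (rule v(2), rule normalized[OF h pos])
    also have "\<dots> = form_on I A (\<lambda>x. r * h x) (\<lambda>x. r * h x)"
      by (rule form_on_cong) (simp_all add: cut_def r_def)
    also have "\<dots> = r * r * form_on I A h h"
      by (simp only: form_on_scale_left form_on_scale_right mult.assoc)
    also have "\<dots> = form_on I A h h / dot_on I h h"
      using pos by (simp add: r_def)
    finally show ?thesis using pos by (simp add: pos_le_divide_eq)
  qed
  then show ?thesis using v(1) unfolding K_def by blast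
qed

lemma linear_term_vanishes_if_quadratic_nonneg:
  fixes b c :: real
  assumes "\<And>t. 0 \<le> 2 * t * b + t\<^sup>2 * c"
  shows "b = 0"
proof (rule ccontr)
  assume "b \<noteq> 0"
  define s where "s = 1 / (1 + \<bar>c\<bar>)"
  have s: "s > 0" "s * \<bar>c\<bar> < 1" by (auto simp: s_def field_simps)
  have "0 \<le> 2 * (- s * b) * b + (- s * b)\<^sup>2 * c" by (rule assms)
  also have "\<dots> = s * b\<^sup>2 * (s * c - 2)" by (simp add: power2_eq_square algebra_simps)
  also have "\<dots> < 0"
  proof -
    have "s * c \<le> s * \<bar>c\<bar>" using s by (intro mult_left_mono) auto
    then have "s * c < 2" using s by linarith
    then show ?thesis using s \<open>b \<noteq> 0\<close> by (intro mult_pos_neg) auto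
  qed
  finally show False by simp
qed

text \<open>
  Each new vector minimizes the form on the unit sphere of the orthogonal complement of its
  predecessors. Since it is a critical point, the form vanishes between it and everything orthogonal
  to it and to its predecessors; in particular later choices diagonalize the form.
\<close>

lemma spectral_decomposition_partial:
  assumes "finite I" and sym: "\<forall>x\<in>I. \<forall>y\<in>I. A x y = A y x"
    and "k \<le> card I"
  shows "\<exists>e. (\<forall>i<k. dot_on I (e i) (e i) = 1 \<and> (\<forall>j<i. dot_on I (e j) (e i) = 0) \<and>
     (\<forall>h. (\<forall>j<i. dot_on I (e j) h = 0) \<longrightarrow>
        form_on I A (e i) (e i) * dot_on I h h \<le> form_on I A h h \<and>
        (dot_on I (e i) h = 0 \<longrightarrow> form_on I A (e i) h = 0)))"
  using assms(3)
proof (induction k)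
  case 0
  then show ?case by simp
next
  case (Suc k)
  let ?P = "\<lambda>e i. dot_on I (e i) (e i) = 1 \<and> (\<forall>j<i. dot_on I (e j) (e i) = 0) \<and>
     (\<forall>h. (\<forall>j<i. dot_on I (e j) h = 0) \<longrightarrow>
        form_on I A (e i) (e i) * dot_on I h h \<le> form_on I A h h \<and>
        (dot_on I (e i) h = 0 \<longrightarrow> form_on I A (e i) h = 0))"
  obtain e where e: "\<And>i. i < k \<Longrightarrow> ?P e i" using Suc by auto
  obtain v where v: "dot_on I v v = 1" "\<forall>j<k. dot_on I (e j) v = 0"
     "\<And>h. \<forall>j<k. dot_on I (e j) h = 0 \<Longrightarrow> form_on I A v v * dot_on I h h \<le> form_on I A h h"
    using form_on_minimizer_exists[OF assms(1), of k e A] Suc.prems by auto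
  \<comment> \<open>first-order condition at the minimizer \<open>v\<close>, along the curve \<open>v + t h\<close>\<close>
  have crit: "form_on I A v h = 0" if h: "\<forall>j<k. dot_on I (e j) h = 0" "dot_on I v h = 0" for h
  proof (rule linear_term_vanishes_if_quadratic_nonneg)
    fix t :: real
    let ?w = "\<lambda>x. v x + t * h x"
    have orth_w: "\<forall>j<k. dot_on I (e j) ?w = 0"
      using v(2) h by (simp add: dot_on_add_right dot_on_scale_right)
    have "form_on I A v v * (1 + t\<^sup>2 * dot_on I h h)
        \<le> form_on I A v v + 2 * t * form_on I A v h + t\<^sup>2 * form_on I A h h"
    proof -
      have "dot_on I ?w ?w = 1 + t\<^sup>2 * dot_on I h h"
        using v(1) h(2) dot_on_commute[of I h v]
        by (simp add: dot_on_add_right dot_on_add_left dot_on_scale_right dot_on_scale_left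
            power2_eq_square)
      moreover have "form_on I A ?w ?w = form_on I A v v + 2 * t * form_on I A v h + t\<^sup>2 * form_on I A h h"
        using form_on_commute[where A=A and u=h and v=v, OF sym]
        by (simp add: form_on_add_left form_on_add_right form_on_scale_left form_on_scale_right
            power2_eq_square algebra_simps)
      ultimately show ?thesis using v(3)[OF orth_w] by simp
    qed
    then show "0 \<le> 2 * t * form_on I A v h + t\<^sup>2 * (form_on I A h h - form_on I A v v * dot_on I h h)"
      by (simp add: algebra_simps)
  qed
  define e' where "e' = e(k := v)"
  have "?P e' i" if "i < Suc k" for i
  proof (cases "i = k")
    case True
    then show ?thesis using v crit by (auto simp: e'_def)
  next
    case False
    then have "i < k" using that by simp
    then show ?thesis using e[of i] by (auto simp: e'_def)
  qed
  then show ?case by blast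
qed

text \<open>
  The spectral theorem for a real symmetric matrix, in the form needed here: the values increase
  because the minimization runs over shrinking subspaces, and the last clause is the variational
  lower bound on the complement of the first \<open>i\<close> eigenvectors.
\<close>

lemma sorted_spectral_decomposition:
  assumes I: "finite I" and sym: "\<forall>x\<in>I. \<forall>y\<in>I. A x y = A y x"
  shows "\<exists>(e :: nat \<Rightarrow> 'i \<Rightarrow> real) \<mu>.
    (\<forall>i<card I. \<forall>j<card I. dot_on I (e i) (e j) = (if i = j then 1 else 0)) \<and>
    (\<forall>i<card I. \<forall>j<card I. form_on I A (e i) (e j) = (if i = j then \<mu> i else 0)) \<and>
    (\<forall>i j. i \<le> j \<and> j < card I \<longrightarrow> \<mu> i \<le> \<mu> j) \<and>
    (\<forall>i<card I. \<forall>h. (\<forall>j<i. dot_on I (e j) h = 0) \<longrightarrow> \<mu> i * dot_on I h h \<le> form_on I A h h)"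
proof -
  obtain e where e: "\<And>i. i < card I \<Longrightarrow> dot_on I (e i) (e i) = 1"
    "\<And>i j. i < card I \<Longrightarrow> j < i \<Longrightarrow> dot_on I (e j) (e i) = 0"
    "\<And>i h. i < card I \<Longrightarrow> (\<And>j. j < i \<Longrightarrow> dot_on I (e j) h = 0) \<Longrightarrow>
        form_on I A (e i) (e i) * dot_on I h h \<le> form_on I A h h"
    "\<And>i h. i < card I \<Longrightarrow> (\<And>j. j < i \<Longrightarrow> dot_on I (e j) h = 0) \<Longrightarrow>
        dot_on I (e i) h = 0 \<Longrightarrow> form_on I A (e i) h = 0"
    using spectral_decomposition_partial[where A=A, OF I sym order.refl] by blast
  define \<mu> where "\<mu> i = form_on I A (e i) (e i)" for i
  have orth: "dot_on I (e i) (e j) = (if i = j then 1 else 0)" if "i < card I" "j < card I" for i j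
    using e(1)[of i] e(2)[of i j] e(2)[of j i] that dot_on_commute[of I "e i" "e j"]
    by (cases i j rule: linorder_cases) auto
  have less: "form_on I A (e i) (e j) = 0" if "i < j" "j < card I" for i j
    using that by (intro e(4)) (auto simp: orth)
  have diag: "form_on I A (e i) (e j) = (if i = j then \<mu> i else 0)" if "i < card I" "j < card I" for i j
    using less[of i j] less[of j i] that form_on_commute[where A=A and u="e i" and v="e j", OF sym]
    by (cases i j rule: linorder_cases) (auto simp: \<mu>_def)
  have mono: "\<mu> i \<le> \<mu> j" if "i \<le> j" "j < card I" for i j
  proof -
    have "\<mu> i * dot_on I (e j) (e j) \<le> form_on I A (e j) (e j)"
      unfolding \<mu>_def using that by (intro e(3)) (auto simp: orth)
    then show ?thesis using that by (simp add: orth \<mu>_def)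
  qed
  have min: "\<mu> i * dot_on I h h \<le> form_on I A h h"
    if "i < card I" "\<forall>j<i. dot_on I (e j) h = 0" for i h
    using e(3)[of i h] that unfolding \<mu>_def by blast
  show ?thesis
    by (rule exI[of _ e], rule exI[of _ \<mu>], intro conjI allI impI)
      (use orth diag mono min in blast)+
qed

text \<open>
  The rows of a square matrix with orthonormal columns are orthonormal too. The residual of a
  coordinate vector after expansion would otherwise be one orthogonal direction too many.
\<close>

lemma orthonormal_completeness:
  assumes I: "finite I"
    and orth: "\<And>i j. i < card I \<Longrightarrow> j < card I \<Longrightarrow> dot_on I (e i) (e j) = (if i = j then 1 else 0)"
    and "x \<in> I" "y \<in> I"
  shows "(\<Sum>j<card I. e j x * e j y) = (if x = y then 1 else 0)"
proof -
  define n where "n = card I"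
  define d :: "'a \<Rightarrow> real" where "d z = (if z = x then 1 else 0)" for z
  define r where "r z = d z - (\<Sum>j<n. e j x * e j z)" for z
  have de: "dot_on I (e i) d = e i x" for i
  proof -
    have "dot_on I (e i) d = (\<Sum>z\<in>I. if z = x then e i x else 0)"
      unfolding dot_on_def by (intro sum.cong) (auto simp: d_def)
    then show ?thesis using I \<open>x \<in> I\<close> by simp
  qed
  have orth_r: "dot_on I (e i) r = 0" if "i < n" for i
  proof -
    have "dot_on I (e i) r = e i x - (\<Sum>j<n. e j x * dot_on I (e i) (e j))"
      unfolding r_def dot_on_diff_right de by (simp add: dot_on_sum_right)
    also have "(\<Sum>j<n. e j x * dot_on I (e i) (e j)) = (\<Sum>j<n. if j = i then e i x else 0)"
      using that by (intro sum.cong) (auto simp: orth n_def)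
    finally show ?thesis using that by simp
  qed
  then have orth_r': "dot_on I r (e i) = 0" if "i < n" for i
    using that by (simp add: dot_on_commute)
  \<comment> \<open>\<open>n + 1\<close> nonzero orthogonal vectors cannot exist in dimension \<open>n\<close>\<close>
  have "dot_on I r r = 0"
  proof (rule ccontr)
    assume nz: "dot_on I r r \<noteq> 0"
    define f where "f = e(n := r)"
    obtain c where c: "\<exists>i\<in>{..n}. c i \<noteq> 0" "\<forall>z\<in>I. (\<Sum>i\<in>{..n}. f i z * c i) = 0"
      using underdetermined_system_nontrivial_solution[OF I, of "{..n}" "\<lambda>z i. f i z"]
      by (auto simp: n_def)
    have "c i = 0" if "i \<le> n" for i
    proof -
      have "0 = dot_on I (f i) (\<lambda>z. \<Sum>j\<le>n. c j * f j z)"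
        using c(2) by (simp add: dot_on_def mult.commute)
      also have "\<dots> = (\<Sum>j\<le>n. c j * dot_on I (f i) (f j))" by (rule dot_on_sum_right)
      also have "\<dots> = (\<Sum>j\<le>n. if j = i then c i * dot_on I (f i) (f i) else 0)"
        using that orth_r orth_r'
        by (intro sum.cong) (auto simp: f_def orth n_def)
      finally have "c i * dot_on I (f i) (f i) = 0" using that by simp
      moreover have "dot_on I (f i) (f i) \<noteq> 0"
        using that nz by (auto simp: f_def orth n_def)
      ultimately show ?thesis by simp
    qed
    then show False using c(1) by auto
  qed
  then have "r y = 0" using dot_on_eq_zero[OF I] \<open>y \<in> I\<close> by auto
  then show ?thesis by (auto simp: r_def d_def n_def split: if_splits)
qed

lemma trace_eq_sum_diagonal_form:
  assumes I: "finite I"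
    and orth: "\<And>i j. i < card I \<Longrightarrow> j < card I \<Longrightarrow> dot_on I (e i) (e j) = (if i = j then 1 else 0)"
  shows "(\<Sum>j<card I. form_on I A (e j) (e j)) = (\<Sum>x\<in>I. A x x)"
proof -
  have "(\<Sum>j<card I. form_on I A (e j) (e j)) = (\<Sum>x\<in>I. \<Sum>j<card I. \<Sum>y\<in>I. A x y * (e j x * e j y))"
    unfolding form_on_def by (subst sum.swap) (simp add: mult_ac)
  also have "\<dots> = (\<Sum>x\<in>I. \<Sum>y\<in>I. A x y * (\<Sum>j<card I. e j x * e j y))"
    unfolding sum_distrib_left by (intro sum.cong refl, subst sum.swap) simp
  also have "\<dots> = (\<Sum>x\<in>I. \<Sum>y\<in>I. if y = x then A x x else 0)"
    by (intro sum.cong refl) (auto simp: orthonormal_completeness[OF I orth])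
  also have "\<dots> = (\<Sum>x\<in>I. A x x)" using I by simp
  finally show ?thesis .
qed

section \<open>Gaps between two ordered quadratic forms\<close>

lemma orthonormal_combination_forms:
  assumes orth: "\<And>i j. i < n \<Longrightarrow> j < n \<Longrightarrow> dot_on I (f i) (f j) = (if i = j then 1 else 0)"
    and diag: "\<And>i j. i < n \<Longrightarrow> j < n \<Longrightarrow> form_on I B (f i) (f j) = (if i = j then \<nu> i else (0::real))"
    and J: "finite J" "J \<subseteq> {..<n}"
  defines "v \<equiv> \<lambda>c x. \<Sum>i\<in>J. c i * f i x"
  shows "dot_on I (v c) (v c) = (\<Sum>i\<in>J. (c i)\<^sup>2)" "form_on I B (v c) (v c) = (\<Sum>i\<in>J. \<nu> i * (c i)\<^sup>2)"
proof -
  have "dot_on I (v c) (v c) = (\<Sum>i\<in>J. c i * (\<Sum>j\<in>J. c j * dot_on I (f i) (f j)))"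
    by (simp add: v_def dot_on_sum_left dot_on_sum_right)
  also have "\<dots> = (\<Sum>i\<in>J. c i * (\<Sum>j\<in>J. if j = i then c i else 0))"
    using J by (intro sum.cong arg_cong2[of _ _ _ _ "(*)"] refl) (auto simp: orth subset_iff)
  finally show "dot_on I (v c) (v c) = (\<Sum>i\<in>J. (c i)\<^sup>2)"
    using J by (simp add: power2_eq_square)
  have left: "form_on I B (v c) w = (\<Sum>i\<in>J. c i * form_on I B (f i) w)" for w
  proof -
    have "(\<Sum>x\<in>I. B x y * v c x) = (\<Sum>i\<in>J. c i * (\<Sum>x\<in>I. B x y * f i x))" for y
      unfolding v_def sum_distrib_left by (subst sum.swap) (simp add: mult_ac)
    then show ?thesis by (simp add: form_on_eq_dot_on dot_on_sum_left)
  qed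
  have "form_on I B (v c) (v c) = (\<Sum>i\<in>J. c i * (\<Sum>j\<in>J. c j * form_on I B (f i) (f j)))"
    unfolding left unfolding v_def form_on_sum_right ..
  also have "\<dots> = (\<Sum>i\<in>J. c i * (\<Sum>j\<in>J. if j = i then c i * \<nu> i else 0))"
    using J by (intro sum.cong arg_cong2[of _ _ _ _ "(*)"] refl) (auto simp: diag subset_iff)
  finally show "form_on I B (v c) (v c) = (\<Sum>i\<in>J. \<nu> i * (c i)\<^sup>2)"
    using J by (simp add: power2_eq_square mult_ac)
qed

text \<open>
  For \<open>A \<le> B\<close> with sorted eigenvalues \<open>\<mu>\<close> and \<open>\<nu>\<close>, Weyl's monotonicity gives intervals
  \<open>[\<mu>\<^sub>j, \<nu>\<^sub>j]\<close> of total length \<open>tr B - tr A\<close>. A number \<open>l\<close> outside all of them lies between the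
  \<open>k\<close>-th and the next index for both matrices at once: \<open>B\<close> is below \<open>l\<close> on the span \<open>V\<close> of its
  first \<open>k\<close> eigenvectors, and \<open>A\<close> is above \<open>l\<close> on the complement \<open>W\<close> of its own first \<open>k\<close>.
  As \<open>A \<le> B\<close>, the spaces \<open>V\<close> and \<open>W\<close> meet only in zero, and their dimensions add up, so they
  are complementary; \<open>P\<close> is the projection onto \<open>V\<close> along \<open>W\<close>. Any operator between \<open>A\<close> and \<open>B\<close>
  is then below \<open>l\<close> on \<open>V\<close> and above \<open>l\<close> on \<open>W\<close>.
\<close>

lemma eigenvalue_intervals_and_gap_splitting:
  fixes A B :: "'i \<Rightarrow> 'i \<Rightarrow> real"
  assumes I: "finite I"
    and symA: "\<forall>x\<in>I. \<forall>y\<in>I. A x y = A y x"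
    and symB: "\<forall>x\<in>I. \<forall>y\<in>I. B x y = B y x"
    and le: "\<And>u. form_on I A u u \<le> form_on I B u u"
  shows "\<exists>(\<mu> :: nat \<Rightarrow> real) \<nu>.
    (\<forall>j<card I. \<mu> j \<le> \<nu> j) \<and>
    (\<Sum>j<card I. \<nu> j - \<mu> j) = (\<Sum>x\<in>I. B x x - A x x) \<and>
    (\<forall>l. (\<forall>j<card I. l \<notin> {\<mu> j..\<nu> j}) \<longrightarrow> (\<exists>P \<epsilon>. \<epsilon> > 0 \<and>
       (\<forall>u. let v = (\<lambda>x. \<Sum>y\<in>I. P x y * u y); w = (\<lambda>x. u x - v x) in
          form_on I B v v \<le> (l - \<epsilon>) * dot_on I v v \<and> (l + \<epsilon>) * dot_on I w w \<le> form_on I A w w)))"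
proof -
  define n where "n = card I"
  obtain e \<mu> where
    "\<forall>i<n. \<forall>j<n. dot_on I (e i) (e j) = (if i = j then 1 else 0)"
    "\<forall>i<n. \<forall>j<n. form_on I A (e i) (e j) = (if i = j then \<mu> i else 0)"
    "\<forall>i j. i \<le> j \<and> j < n \<longrightarrow> \<mu> i \<le> \<mu> j"
    "\<forall>i<n. \<forall>h. (\<forall>j<i. dot_on I (e j) h = 0) \<longrightarrow> \<mu> i * dot_on I h h \<le> form_on I A h h"
    using sorted_spectral_decomposition[where A=A, OF I symA, folded n_def] by (elim exE conjE)
  then have e:
    "\<And>i j. i < n \<Longrightarrow> j < n \<Longrightarrow> dot_on I (e i) (e j) = (if i = j then 1 else 0)"
    "\<And>i j. i < n \<Longrightarrow> j < n \<Longrightarrow> form_on I A (e i) (e j) = (if i = j then \<mu> i else 0)"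
    "\<And>i j. i \<le> j \<Longrightarrow> j < n \<Longrightarrow> \<mu> i \<le> \<mu> j"
    "\<And>i h. i < n \<Longrightarrow> (\<And>j. j < i \<Longrightarrow> dot_on I (e j) h = 0) \<Longrightarrow> \<mu> i * dot_on I h h \<le> form_on I A h h"
    by simp_all
  obtain f \<nu> where
    "\<forall>i<n. \<forall>j<n. dot_on I (f i) (f j) = (if i = j then 1 else 0)"
    "\<forall>i<n. \<forall>j<n. form_on I B (f i) (f j) = (if i = j then \<nu> i else 0)"
    "\<forall>i j. i \<le> j \<and> j < n \<longrightarrow> \<nu> i \<le> \<nu> j"
    "\<forall>i<n. \<forall>h. (\<forall>j<i. dot_on I (f j) h = 0) \<longrightarrow> \<nu> i * dot_on I h h \<le> form_on I B h h"
    using sorted_spectral_decomposition[where A=B, OF I symB, folded n_def] by (elim exE conjE)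
  then have f:
    "\<And>i j. i < n \<Longrightarrow> j < n \<Longrightarrow> dot_on I (f i) (f j) = (if i = j then 1 else 0)"
    "\<And>i j. i < n \<Longrightarrow> j < n \<Longrightarrow> form_on I B (f i) (f j) = (if i = j then \<nu> i else 0)"
    "\<And>i j. i \<le> j \<Longrightarrow> j < n \<Longrightarrow> \<nu> i \<le> \<nu> j"
    "\<And>i h. i < n \<Longrightarrow> (\<And>j. j < i \<Longrightarrow> dot_on I (f j) h = 0) \<Longrightarrow> \<nu> i * dot_on I h h \<le> form_on I B h h"
    by simp_all
  have span: "dot_on I (\<lambda>x. \<Sum>i\<in>J. c i * f i x) (\<lambda>x. \<Sum>i\<in>J. c i * f i x) = (\<Sum>i\<in>J. (c i)\<^sup>2)"
    "form_on I B (\<lambda>x. \<Sum>i\<in>J. c i * f i x) (\<lambda>x. \<Sum>i\<in>J. c i * f i x) = (\<Sum>i\<in>J. \<nu> i * (c i)\<^sup>2)"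
    if "J \<subseteq> {..<n}" for J c
    using orthonormal_combination_forms[where f=f and n=n and B=B and \<nu>=\<nu>] f(1,2) that
      finite_subset[OF that] by blast+
  have weyl: "\<mu> j \<le> \<nu> j" if j: "j < n" for j
  proof -
    \<comment> \<open>a common vector of the span of \<open>f\<^sub>0, ..., f\<^sub>j\<close> and the complement of \<open>e\<^sub>0, ..., e\<^sub>j\<^sub>-\<^sub>1\<close>\<close>
    obtain c where c: "\<exists>i\<in>{..j}. c i \<noteq> 0" "\<forall>l\<in>{..<j}. (\<Sum>i\<in>{..j}. dot_on I (e l) (f i) * c i) = 0"
      using underdetermined_system_nontrivial_solution[of "{..<j}" "{..j}" "\<lambda>l i. dot_on I (e l) (f i)"] by auto
    define v where "v = (\<lambda>x. \<Sum>i\<in>{..j}. c i * f i x)"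
    have sub: "{..j} \<subseteq> {..<n}" using j by auto
    have dv: "dot_on I v v = (\<Sum>i\<le>j. (c i)\<^sup>2)" and fv: "form_on I B v v = (\<Sum>i\<le>j. \<nu> i * (c i)\<^sup>2)"
      unfolding v_def using span[OF sub] by blast+
    have "dot_on I (e l) v = 0" if "l < j" for l
      using c(2) that by (simp add: v_def dot_on_sum_right mult.commute)
    then have "\<mu> j * dot_on I v v \<le> form_on I A v v" using e(4)[OF j] by blast
    also have "\<dots> \<le> form_on I B v v" by (rule le)
    also have "\<dots> \<le> (\<Sum>i\<le>j. \<nu> j * (c i)\<^sup>2)"
      unfolding fv using f(3) j by (intro sum_mono mult_right_mono) auto
    also have "\<dots> = \<nu> j * dot_on I v v" by (simp add: dv sum_distrib_left)
    finally have "\<mu> j * dot_on I v v \<le> \<nu> j * dot_on I v v" .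
    moreover have "dot_on I v v > 0"
      unfolding dv using c(1) by (intro sum_pos2[of _ "SOME i. i \<in> {..j} \<and> c i \<noteq> 0"])
        (auto, (metis (mono_tags, lifting) atMost_iff someI_ex)+)
    ultimately show ?thesis by simp
  qed
  have "(\<Sum>j<n. \<mu> j) = (\<Sum>x\<in>I. A x x)" "(\<Sum>j<n. \<nu> j) = (\<Sum>x\<in>I. B x x)"
    using trace_eq_sum_diagonal_form[where e=e and A=A, OF I] e(1,2)
      trace_eq_sum_diagonal_form[where e=f and A=B, OF I] f(1,2) by (auto simp: n_def)
  then have trace: "(\<Sum>j<n. \<nu> j - \<mu> j) = (\<Sum>x\<in>I. B x x - A x x)"
    by (simp add: sum_subtractf)
  have splitting: "\<exists>P \<epsilon>. \<epsilon> > 0 \<and>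
       (\<forall>u. let v = (\<lambda>x. \<Sum>y\<in>I. P x y * u y); w = (\<lambda>x. u x - v x) in
          form_on I B v v \<le> (l - \<epsilon>) * dot_on I v v \<and> (l + \<epsilon>) * dot_on I w w \<le> form_on I A w w)"
    if gap: "\<And>j. j < n \<Longrightarrow> l \<notin> {\<mu> j..\<nu> j}" for l
  proof -
    \<comment> \<open>the number of eigenvalues of \<open>B\<close> below \<open>l\<close>\<close>
    define k where "k = (LEAST j. j = n \<or> l \<le> \<nu> j)"
    have k: "k = n \<or> l \<le> \<nu> k" "k \<le> n"
      unfolding k_def by (rule LeastI[of _ n], simp, rule Least_le, simp)
    have below: "\<nu> j < l" if "j < k" for j
      using not_less_Least[of j "\<lambda>j. j = n \<or> l \<le> \<nu> j"] that unfolding k_def by auto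
    have above: "l < \<mu> k" if "k < n"
      using gap[OF that] k that by auto
    \<comment> \<open>the two fallback values \<open>1\<close> belong to the cases \<open>V = 0\<close> and \<open>W = 0\<close>\<close>
    define \<epsilon> where "\<epsilon> = min (if k = 0 then 1 else l - \<nu> (k - 1)) (if k < n then \<mu> k - l else 1)"
    have \<epsilon>: "\<epsilon> > 0" using below[of "k - 1"] above by (auto simp: \<epsilon>_def)
    have \<nu>\<epsilon>: "\<nu> j \<le> l - \<epsilon>" if "j < k" for j
    proof -
      have "\<nu> j \<le> \<nu> (k - 1)" using f(3)[of j "k - 1"] that k by auto
      moreover have "\<epsilon> \<le> l - \<nu> (k - 1)" using that by (auto simp: \<epsilon>_def)
      ultimately show ?thesis by simp
    qed
    have \<mu>\<epsilon>: "l + \<epsilon> \<le> \<mu> k" if "k < n" using that by (auto simp: \<epsilon>_def)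
    let ?V = "\<lambda>c x. \<Sum>i<k. c i * f i x"
    have V: "form_on I B (?V c) (?V c) \<le> (l - \<epsilon>) * dot_on I (?V c) (?V c)" for c
    proof -
      have "form_on I B (?V c) (?V c) = (\<Sum>i<k. \<nu> i * (c i)\<^sup>2)" using k by (subst span(2)) auto
      also have "\<dots> \<le> (\<Sum>i<k. (l - \<epsilon>) * (c i)\<^sup>2)"
        using \<nu>\<epsilon> by (intro sum_mono mult_right_mono) auto
      also have "\<dots> = (l - \<epsilon>) * dot_on I (?V c) (?V c)"
        using k by (subst span(1)) (auto simp: sum_distrib_left)
      finally show ?thesis .
    qed
    have W: "(l + \<epsilon>) * dot_on I h h \<le> form_on I A h h" if h: "\<And>j. j < k \<Longrightarrow> dot_on I (e j) h = 0" for h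
    proof (cases "k < n")
      case True
      have "(l + \<epsilon>) * dot_on I h h \<le> \<mu> k * dot_on I h h"
        using \<mu>\<epsilon>[OF True] dot_on_ge_zero by (intro mult_right_mono)
      also have "\<dots> \<le> form_on I A h h" using e(4)[OF True] h by blast
      finally show ?thesis .
    next
      case False
      have "h x = 0" if "x \<in> I" for x
      proof -
        have "h x = (\<Sum>y\<in>I. if y = x then h y else 0)" using I that by simp
        also have "\<dots> = (\<Sum>y\<in>I. (\<Sum>j<n. e j x * e j y) * h y)"
          using orthonormal_completeness[OF I, of e] e(1) that by (intro sum.cong) (auto simp: n_def)
        also have "\<dots> = (\<Sum>j<n. e j x * dot_on I (e j) h)"
          unfolding dot_on_def sum_distrib_left sum_distrib_right by (subst sum.swap) (simp add: mult_ac)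
        also have "\<dots> = 0" using h False k by simp
        finally show ?thesis .
      qed
      then show ?thesis by (simp add: dot_on_def form_on_def)
    qed
    have transversal: "c i = 0" if c: "\<And>j. j < k \<Longrightarrow> dot_on I (e j) (?V c) = 0" and "i < k" for c i
    proof -
      have "(l + \<epsilon>) * dot_on I (?V c) (?V c) \<le> (l - \<epsilon>) * dot_on I (?V c) (?V c)"
        using W[OF c] V[of c] le[of "?V c"] by linarith
      then have "\<epsilon> * dot_on I (?V c) (?V c) \<le> 0" by (simp add: algebra_simps)
      then have "dot_on I (?V c) (?V c) \<le> 0" using \<epsilon> by (simp add: mult_le_0_iff)
      then have "(\<Sum>i<k. (c i)\<^sup>2) \<le> 0" using k by (subst (asm) span(1)) auto
      then have "(\<Sum>i<k. (c i)\<^sup>2) = 0" by (intro antisym sum_nonneg) auto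
      then show ?thesis using \<open>i < k\<close> by (simp add: sum_nonneg_eq_0_iff)
    qed
    \<comment> \<open>the coordinates of the projection of the unit vector at \<open>y\<close>\<close>
    have "\<exists>c. \<forall>j<k. (\<Sum>i<k. c i * dot_on I (e j) (f i)) = e j y" for y
    proof -
      \<comment> \<open>a square system with trivial kernel is solved by making the right-hand side an extra unknown\<close>
      let ?M = "\<lambda>j i. if i < k then dot_on I (e j) (f i) else - e j y"
      obtain c where c: "\<exists>i\<in>{..k}. c i \<noteq> 0" "\<forall>j\<in>{..<k}. (\<Sum>i\<in>{..k}. ?M j i * c i) = 0"
        using underdetermined_system_nontrivial_solution[of "{..<k}" "{..k}" ?M] by auto
      have eq: "(\<Sum>i<k. c i * dot_on I (e j) (f i)) = c k * e j y" if "j < k" for j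
      proof -
        have "0 = (\<Sum>i<Suc k. ?M j i * c i)" using c(2) that by (simp add: lessThan_Suc_atMost)
        also have "\<dots> = (\<Sum>i<k. c i * dot_on I (e j) (f i)) - c k * e j y"
          unfolding sum.lessThan_Suc by (simp add: mult.commute)
        finally show ?thesis by simp
      qed
      have "c k \<noteq> 0"
      proof
        assume "c k = 0"
        have "dot_on I (e j) (?V c) = 0" if "j < k" for j
          unfolding dot_on_sum_right eq[OF that] by (simp add: \<open>c k = 0\<close>)
        then have "c i = 0" if "i < k" for i using transversal that by blast
        then have "c i = 0" if "i \<le> k" for i
          using that \<open>c k = 0\<close> by (cases "i = k") auto
        then show False using c(1) by blast
      qed
      have "(\<Sum>i<k. c i / c k * dot_on I (e j) (f i)) = e j y" if "j < k" for j
        using eq[OF that] \<open>c k \<noteq> 0\<close> by (simp add: sum_divide_distrib[symmetric])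
      then show ?thesis by (intro exI[of _ "\<lambda>i. c i / c k"]) auto
    qed
    then obtain c where c: "\<And>y j. j < k \<Longrightarrow> (\<Sum>i<k. c y i * dot_on I (e j) (f i)) = e j y" by metis
    define P where "P x y = (\<Sum>i<k. c y i * f i x)" for x y
    have "form_on I B v v \<le> (l - \<epsilon>) * dot_on I v v \<and> (l + \<epsilon>) * dot_on I w w \<le> form_on I A w w"
      if v: "v = (\<lambda>x. \<Sum>y\<in>I. P x y * u y)" and w: "w = (\<lambda>x. u x - v x)" for u v w
    proof -
      have v': "v = ?V (\<lambda>i. \<Sum>y\<in>I. c y i * u y)"
        unfolding v P_def sum_distrib_right by (subst sum.swap) (simp add: mult_ac)
      have "dot_on I (e j) w = 0" if "j < k" for j
      proof -
        have "dot_on I (e j) v = (\<Sum>i<k. \<Sum>y\<in>I. u y * (c y i * dot_on I (e j) (f i)))"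
          unfolding v' dot_on_sum_right by (simp add: sum_distrib_left mult_ac)
        also have "\<dots> = (\<Sum>y\<in>I. u y * (\<Sum>i<k. c y i * dot_on I (e j) (f i)))"
          unfolding sum_distrib_left by (rule sum.swap)
        also have "\<dots> = dot_on I (e j) u" using c[OF that] by (simp add: dot_on_def mult.commute)
        finally show ?thesis by (simp add: w dot_on_diff_right)
      qed
      then show ?thesis using V W v' by auto
    qed
    then show ?thesis using \<epsilon> unfolding Let_def by blast
  qed
  show ?thesis
  proof (rule exI[of _ \<mu>], rule exI[of _ \<nu>], intro conjI allI impI)
    show "\<mu> j \<le> \<nu> j" if "j < card I" for j using weyl that by (simp add: n_def)
    show "(\<Sum>j<card I. \<nu> j - \<mu> j) = (\<Sum>x\<in>I. B x x - A x x)" using trace by (simp add: n_def)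
  qed (rule splitting, simp add: n_def)
qed

section \<open>Invertible operators on Hilbert spaces\<close>

definition boundedly_invertible :: "('a::real_normed_vector \<Rightarrow> 'b::real_normed_vector) \<Rightarrow> bool" where
  "boundedly_invertible Q \<longleftrightarrow> surj Q \<and> (\<exists>C. \<forall>u. norm u \<le> C * norm (Q u))"

text \<open>
  The equation \<open>Q x = f + D x\<close> is solved by Banach's fixed point theorem, which gives surjectivity;
  the lower bound for \<open>Q\<close> absorbs \<open>D\<close>.
\<close>

lemma boundedly_invertible_small_perturbation:
  fixes Q D :: "'a::{real_normed_vector, complete_space} \<Rightarrow> 'b::real_normed_vector"
  assumes Q: "linear Q" "surj Q" "\<And>u. norm u \<le> C * norm (Q u)"
    and D: "linear D" "\<And>u. C * norm (D u) \<le> q * norm u"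
    and q: "0 \<le> q" "q < 1" and "0 \<le> C"
  shows "boundedly_invertible (\<lambda>u. Q u - D u)"
proof -
  have "\<exists>x. f = Q x - D x" for f
  proof -
    define \<Phi> where "\<Phi> x = (SOME y. Q y = f + D x)" for x
    have \<Phi>: "Q (\<Phi> x) = f + D x" for x
      unfolding \<Phi>_def using Q(2) by (metis (mono_tags) someI_ex surjD)
    have "dist (\<Phi> x) (\<Phi> y) \<le> q * dist x y" for x y
    proof -
      have "dist (\<Phi> x) (\<Phi> y) \<le> C * norm (Q (\<Phi> x - \<Phi> y))"
        unfolding dist_norm by (rule Q(3))
      also have "Q (\<Phi> x - \<Phi> y) = D (x - y)"
        by (simp add: linear_diff[OF Q(1)] linear_diff[OF D(1)] \<Phi>)
      also have "C * norm (D (x - y)) \<le> q * dist x y"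
        unfolding dist_norm by (rule D(2))
      finally show ?thesis .
    qed
    then obtain x where "\<Phi> x = x" using banach_fix_type[OF q, of \<Phi>] by auto
    then show ?thesis using \<Phi>[of x] by (intro exI[of _ x]) simp
  qed
  moreover have "norm u \<le> C / (1 - q) * norm (Q u - D u)" for u
  proof -
    have "norm u \<le> C * norm (Q u)" by (rule Q(3))
    also have "\<dots> \<le> C * (norm (Q u - D u) + norm (D u))"
      using norm_triangle_ineq[of "Q u - D u" "D u"] \<open>0 \<le> C\<close> by (intro mult_left_mono) auto
    also have "\<dots> \<le> C * norm (Q u - D u) + q * norm u"
      using D(2)[of u] by (simp add: distrib_left)
    finally show ?thesis using q by (simp add: field_simps)
  qed
  ultimately show ?thesis unfolding boundedly_invertible_def surj_def by blast
qed

text \<open>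
  The Lax-Milgram lemma: for the right step length \<open>t\<close>, the map \<open>u - t T u\<close> is a contraction, so that
  \<open>t T\<close> is a small perturbation of the identity.
\<close>

lemma coercive_boundedly_invertible:
  fixes T :: "'a::{real_inner, complete_space} \<Rightarrow> 'a"
  assumes T: "bounded_linear T" and "c > 0" and coercive: "\<And>u. c * (norm u)\<^sup>2 \<le> T u \<bullet> u"
  shows "boundedly_invertible T"
proof -
  obtain K0 where K0: "\<And>u. norm (T u) \<le> norm u * K0"
    using bounded_linear.bounded[OF T] by blast
  \<comment> \<open>\<open>K \<ge> c\<close> keeps the radicand in the definition of \<open>q\<close> nonnegative, also in the zero space\<close>
  define K where "K = max K0 c"
  have K: "norm (T u) \<le> K * norm u" "K \<ge> c" "K > 0" for u
    using K0[of u] mult_left_mono[of K0 K "norm u"] \<open>c > 0\<close> by (auto simp: K_def mult.commute)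
  \<comment> \<open>minimizes the bound \<open>1 - 2 t c + t\<^sup>2 K\<^sup>2\<close> for the squared contraction factor\<close>
  define t where "t = c / K\<^sup>2"
  have t: "t > 0" using \<open>c > 0\<close> K by (simp add: t_def)
  define q where "q = sqrt (1 - c\<^sup>2 / K\<^sup>2)"
  have "c\<^sup>2 / K\<^sup>2 \<le> 1" using K \<open>c > 0\<close> by (simp add: power_mono)
  then have q: "0 \<le> q" "q < 1" "q\<^sup>2 = 1 - c\<^sup>2 / K\<^sup>2"
    using K \<open>c > 0\<close> by (auto simp: q_def)
  have contraction: "norm (u - t *\<^sub>R T u) \<le> q * norm u" for u
  proof (rule power2_le_imp_le)
    have "(norm (u - t *\<^sub>R T u))\<^sup>2 = (norm u)\<^sup>2 - 2 * t * (T u \<bullet> u) + t\<^sup>2 * (norm (T u))\<^sup>2"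
      unfolding power2_norm_eq_inner
      by (simp add: inner_diff_left inner_diff_right inner_commute power2_eq_square algebra_simps)
    also have "\<dots> \<le> (norm u)\<^sup>2 - 2 * t * (c * (norm u)\<^sup>2) + t\<^sup>2 * (K * norm u)\<^sup>2"
      using coercive[of u] K(1)[of u] t
      by (intro add_mono diff_mono mult_left_mono power_mono) auto
    also have "\<dots> = (norm u)\<^sup>2 * (1 - 2 * (t * c) + t * (t * K\<^sup>2))"
      by (simp add: power2_eq_square algebra_simps)
    also have "t * K\<^sup>2 = c" using K by (simp add: t_def)
    also have "1 - 2 * (t * c) + t * c = q\<^sup>2"
      unfolding q(3) by (simp add: t_def power2_eq_square)
    finally show "(norm (u - t *\<^sub>R T u))\<^sup>2 \<le> (q * norm u)\<^sup>2"
      by (simp add: power_mult_distrib mult.commute)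
  qed (use q in simp)
  have "linear (\<lambda>u. u - t *\<^sub>R T u)"
    using T by (intro linear_compose_sub linear_compose_scale_right linear_ident bounded_linear.linear)
  then have "boundedly_invertible (\<lambda>u. u - (u - t *\<^sub>R T u))"
    using q contraction by (intro boundedly_invertible_small_perturbation[where C=1 and q=q]) (auto intro: linear_ident)
  then have surj: "surj (\<lambda>u. t *\<^sub>R T u)" and "\<exists>C. \<forall>u. norm u \<le> C * norm (t *\<^sub>R T u)"
    by (auto simp: boundedly_invertible_def)
  then obtain C where C: "\<And>u. norm u \<le> C * norm (t *\<^sub>R T u)" by blast
  have "\<exists>u. f = T u" for f
    using surjD[OF surj, of "t *\<^sub>R f"] t by auto
  moreover have "norm u \<le> (C * t) * norm (T u)" for u
    using C[of u] t by (simp add: mult_ac)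
  ultimately show ?thesis unfolding boundedly_invertible_def surj_def by blast
qed

text \<open>
  A symmetric \<open>Q\<close> that is negative definite on the range of \<open>P\<close> and positive definite on the range of
  \<open>1 - P\<close> becomes coercive after reflecting the first part: with \<open>J = 1 - 2 P\<close>, the cross terms of
  \<open>Q u \<bullet> J u\<close> cancel by symmetry. So \<open>Q \<circ> J\<close> is onto by the Lax-Milgram lemma, and the same
  inequality bounds \<open>Q\<close> from below.
\<close>

lemma boundedly_invertible_if_definite_splitting:
  fixes Q P :: "'a::{real_inner, complete_space} \<Rightarrow> 'a"
  assumes Q: "bounded_linear Q" and P: "bounded_linear P"
    and sym: "\<And>u v. Q u \<bullet> v = u \<bullet> Q v" and "\<epsilon> > 0"
    and neg: "\<And>u. Q (P u) \<bullet> P u \<le> - \<epsilon> * (norm (P u))\<^sup>2"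
    and pos: "\<And>u. \<epsilon> * (norm (u - P u))\<^sup>2 \<le> Q (u - P u) \<bullet> (u - P u)"
  shows "boundedly_invertible Q"
proof -
  define J where "J u = u - 2 *\<^sub>R P u" for u
  have J: "bounded_linear J"
    unfolding J_def by (intro bounded_linear_sub bounded_linear_ident bounded_linear_scaleR_right
        bounded_linear_compose[OF bounded_linear_scaleR_right P])
  have coercive: "\<epsilon> / 2 * (norm u)\<^sup>2 \<le> Q u \<bullet> J u" for u
  proof -
    define v w where "v = P u" and "w = u - P u"
    have u: "u = v + w" "J u = w - v" by (simp_all add: v_def w_def J_def scaleR_2)
    have "Q u \<bullet> J u = Q w \<bullet> w - Q v \<bullet> v"
      using sym[of v w] unfolding u(2) unfolding u(1)
      by (simp add: linear_add[OF bounded_linear.linear[OF Q]] inner_add_left inner_add_right inner_diff_left inner_diff_right inner_commute)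
    then have "\<epsilon> * ((norm v)\<^sup>2 + (norm w)\<^sup>2) \<le> Q u \<bullet> J u"
      using neg[of u] pos[of u] by (simp add: v_def w_def distrib_left)
    moreover
    have "(norm u)\<^sup>2 \<le> 2 * ((norm v)\<^sup>2 + (norm w)\<^sup>2)"
    proof -
      have "0 \<le> (norm (v - w))\<^sup>2" by simp
      then show ?thesis unfolding u
        by (simp add: power2_norm_eq_inner inner_add_left inner_add_right inner_diff_left inner_diff_right)
    qed
    then have "\<epsilon> / 2 * (norm u)\<^sup>2 \<le> \<epsilon> / 2 * (2 * ((norm v)\<^sup>2 + (norm w)\<^sup>2))"
      using \<open>\<epsilon> > 0\<close> by (intro mult_left_mono) auto
    ultimately show ?thesis by (simp add: distrib_left)
  qed
  have "boundedly_invertible (\<lambda>u. Q (J u))"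
  proof (rule coercive_boundedly_invertible)
    show "bounded_linear (\<lambda>u. Q (J u))" by (rule bounded_linear_compose[OF Q J])
    show "\<epsilon> / 2 > 0" using \<open>\<epsilon> > 0\<close> by simp
    show "\<epsilon> / 2 * (norm u)\<^sup>2 \<le> Q (J u) \<bullet> u" for u
      using coercive[of u] sym[of "J u" u] by (simp add: inner_commute)
  qed
  then have surj: "surj (\<lambda>u. Q (J u))" by (simp add: boundedly_invertible_def)
  obtain M where M: "\<And>u. norm (J u) \<le> norm u * M" using bounded_linear.bounded[OF J] by blast
  have "norm u \<le> (2 * M / \<epsilon>) * norm (Q u)" for u
  proof (cases "u = 0")
    case False
    have "\<epsilon> / 2 * (norm u)\<^sup>2 \<le> norm (Q u) * norm (J u)"
      using coercive[of u] norm_cauchy_schwarz[of "Q u" "J u"] by linarith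
    also have "\<dots> \<le> norm (Q u) * (norm u * M)" by (intro mult_left_mono M) simp
    finally have "norm u * (\<epsilon> / 2 * norm u) \<le> norm u * (M * norm (Q u))"
      by (simp add: power2_eq_square mult_ac)
    then have "\<epsilon> / 2 * norm u \<le> M * norm (Q u)" using False by simp
    then show ?thesis using \<open>\<epsilon> > 0\<close> by (simp add: field_simps)
  qed (simp add: linear_0[OF bounded_linear.linear[OF Q]])
  moreover have "\<exists>u. f = Q u" for f
    using surjD[OF surj, of f] by auto
  ultimately show ?thesis unfolding boundedly_invertible_def surj_def by blast
qed

lemma closed_real_spectrum_of_bounded_linear:
  fixes L :: "'a::{real_normed_vector, complete_space} \<Rightarrow> 'a"
  assumes L: "bounded_linear L"
  shows "closed {l. \<not> boundedly_invertible (\<lambda>u. L u - l *\<^sub>R u)}"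
proof -
  have "open {l. boundedly_invertible (\<lambda>u. L u - l *\<^sub>R u)}"
    unfolding open_dist
  proof (intro ballI)
    fix l assume "l \<in> {l. boundedly_invertible (\<lambda>u. L u - l *\<^sub>R u)}"
    then obtain C0 where surj: "surj (\<lambda>u. L u - l *\<^sub>R u)"
      and C0: "\<And>u. norm u \<le> C0 * norm (L u - l *\<^sub>R u)"
      by (auto simp: boundedly_invertible_def)
    define C where "C = max C0 1"
    have C: "norm u \<le> C * norm (L u - l *\<^sub>R u)" "C > 0" for u
      using C0[of u] mult_right_mono[of C0 C "norm (L u - l *\<^sub>R u)"] by (auto simp: C_def)
    have lin: "linear (\<lambda>u. L u - r *\<^sub>R u)" "linear (\<lambda>u :: 'a. r *\<^sub>R u)" for r
      using L by (intro linear_compose_sub linear_compose_scale_right linear_ident bounded_linear.linear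
          bounded_linear_scaleR_right; simp)+
    have "boundedly_invertible (\<lambda>u. L u - r *\<^sub>R u)" if "dist r l < 1 / (2 * C)" for r
    proof -
      have r: "C * \<bar>r - l\<bar> \<le> 1 / 2" using that C by (simp add: dist_real_def field_simps)
      have "boundedly_invertible (\<lambda>u. (L u - l *\<^sub>R u) - (r - l) *\<^sub>R u)"
      proof (rule boundedly_invertible_small_perturbation[where C=C and q="1/2"])
        show "C * norm ((r - l) *\<^sub>R u) \<le> 1 / 2 * norm u" for u :: 'a
          using mult_right_mono[OF r, of "norm u"] by simp
      qed (use lin surj C in auto)
      then show ?thesis by (simp add: scaleR_diff_left)
    qed
    then show "\<exists>e>0. \<forall>r. dist r l < e \<longrightarrow> r \<in> {l. boundedly_invertible (\<lambda>u. L u - l *\<^sub>R u)}"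
      using C by (intro exI[of _ "1 / (2 * C)"]) auto
  qed
  then show ?thesis by (simp add: closed_def Collect_neg_eq)
qed

section \<open>The Hilbert space of square-summable families\<close>

text \<open>
  For nonnegative terms, summability is boundedness of the finite sums; this is how membership of
  weighted compositions and of pointwise limits is checked.
\<close>

lemma ell2_iff_bounded_finite_sums:
  "u \<in> ell2 \<longleftrightarrow> (\<exists>C. \<forall>F. finite F \<longrightarrow> (\<Sum>x\<in>F. (cmod (u x))\<^sup>2) \<le> C)"
proof
  assume "u \<in> ell2"
  then have "(\<lambda>x. (cmod (u x))\<^sup>2) summable_on UNIV" by (simp add: ell2_def)
  then have "(\<Sum>x\<in>F. (cmod (u x))\<^sup>2) \<le> infsum (\<lambda>x. (cmod (u x))\<^sup>2) UNIV" if "finite F" for F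
    by (rule finite_sum_le_infsum[OF _ that]) auto
  then show "\<exists>C. \<forall>F. finite F \<longrightarrow> (\<Sum>x\<in>F. (cmod (u x))\<^sup>2) \<le> C" by blast
next
  assume "\<exists>C. \<forall>F. finite F \<longrightarrow> (\<Sum>x\<in>F. (cmod (u x))\<^sup>2) \<le> C"
  then obtain C where "\<And>F. finite F \<Longrightarrow> (\<Sum>x\<in>F. (cmod (u x))\<^sup>2) \<le> C" by blast
  then have "(\<lambda>x. (cmod (u x))\<^sup>2) summable_on UNIV"
    by (intro nonneg_bounded_partial_sums_imp_summable_on[where C=C] eventually_finite_subsets_at_top_weakI) auto
  then show "u \<in> ell2" by (simp add: ell2_def)
qed

lemma inner_summable_if_ell2:
  assumes "u \<in> ell2" "v \<in> ell2"
  shows "(\<lambda>x. u x \<bullet> v x) summable_on UNIV"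
proof (rule abs_summable_summable, rule summable_on_comparison_test)
  show "(\<lambda>x. (cmod (u x))\<^sup>2 + (cmod (v x))\<^sup>2) summable_on UNIV"
    using assms by (intro summable_on_add) (auto simp: ell2_def)
  show "norm (u x \<bullet> v x) \<le> (cmod (u x))\<^sup>2 + (cmod (v x))\<^sup>2" for x
  proof -
    have "norm (u x \<bullet> v x) \<le> cmod (u x) * cmod (v x)" using Cauchy_Schwarz_ineq2 by simp
    also have "\<dots> \<le> (cmod (u x))\<^sup>2 + (cmod (v x))\<^sup>2"
      using sum_squares_bound[of "cmod (u x)" "cmod (v x)"] mult_nonneg_nonneg[OF norm_ge_zero[of "u x"] norm_ge_zero[of "v x"]]
      by linarith
    finally show ?thesis .
  qed
qed simp

lemma zero_in_ell2: "(\<lambda>_. 0) \<in> ell2"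
  by (simp add: ell2_def)

lemma add_in_ell2:
  assumes "u \<in> ell2" "v \<in> ell2"
  shows "(\<lambda>x. u x + v x) \<in> ell2"
proof -
  have "(\<lambda>x. (cmod (u x + v x))\<^sup>2) = (\<lambda>x. ((cmod (u x))\<^sup>2 + (cmod (v x))\<^sup>2) + 2 * (u x \<bullet> v x))"
    by (simp add: power2_norm_eq_inner inner_add_left inner_add_right inner_commute algebra_simps)
  moreover have "(\<lambda>x. ((cmod (u x))\<^sup>2 + (cmod (v x))\<^sup>2) + 2 * (u x \<bullet> v x)) summable_on UNIV"
    using assms inner_summable_if_ell2[OF assms]
    by (intro summable_on_add summable_on_cmult_right) (auto simp: ell2_def)
  ultimately show ?thesis by (simp add: ell2_def)
qed

lemma scaleR_in_ell2: "u \<in> ell2 \<Longrightarrow> (\<lambda>x. r *\<^sub>R u x) \<in> ell2"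
  by (simp add: ell2_def power_mult_distrib summable_on_cmult_right)

text \<open>
  As a type, the space can be made an instance of the classes of real inner product spaces and of
  complete spaces. The real inner product, which is the real part of the complex one, suffices: all
  operators have real coefficients and only real spectral parameters matter.
\<close>

typedef 'i square_summable = "ell2 :: ('i \<Rightarrow> complex) set"
  morphisms family square_summable
  using zero_in_ell2 by blast

lemma family_in_ell2 [simp]: "family u \<in> ell2"
  by (rule family)

instantiation square_summable :: (type) real_vector
begin

definition zero_square_summable :: "'a square_summable" where
  "0 = square_summable (\<lambda>_. 0)"

definition plus_square_summable :: "'a square_summable \<Rightarrow> 'a square_summable \<Rightarrow> 'a square_summable" where
  "u + v = square_summable (\<lambda>x. family u x + family v x)"

definition scaleR_square_summable :: "real \<Rightarrow> 'a square_summable \<Rightarrow> 'a square_summable" where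
  "r *\<^sub>R u = square_summable (\<lambda>x. r *\<^sub>R family u x)"

definition uminus_square_summable :: "'a square_summable \<Rightarrow> 'a square_summable" where
  "- u = (- 1) *\<^sub>R (u :: 'a square_summable)"

definition minus_square_summable :: "'a square_summable \<Rightarrow> 'a square_summable \<Rightarrow> 'a square_summable" where
  "u - v = u + - (v :: 'a square_summable)"

lemma family_zero: "family 0 x = 0"
  by (simp add: zero_square_summable_def square_summable_inverse zero_in_ell2)

lemma family_add: "family (u + v) x = family u x + family v x"
  by (simp add: plus_square_summable_def square_summable_inverse add_in_ell2)

lemma family_scaleR: "family (r *\<^sub>R u) x = r *\<^sub>R family u x"
  by (simp add: scaleR_square_summable_def square_summable_inverse scaleR_in_ell2)

lemma family_diff: "family (u - v) x = family u x - family v x"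
  by (simp add: minus_square_summable_def uminus_square_summable_def family_add family_scaleR)

lemma family_eqI: "(\<And>x. family u x = family v x) \<Longrightarrow> u = v"
  by (simp add: family_inject[symmetric] fun_eq_iff)

instance
proof
  fix u v w :: "'a square_summable" and r s :: real
  show "u + v + w = u + (v + w)" "u + v = v + u" "0 + u = u" "- u + u = 0"
    "r *\<^sub>R (u + v) = r *\<^sub>R u + r *\<^sub>R v" "(r + s) *\<^sub>R u = r *\<^sub>R u + s *\<^sub>R u"
    "r *\<^sub>R s *\<^sub>R u = (r * s) *\<^sub>R u" "1 *\<^sub>R u = u"
    by (rule family_eqI; simp add: family_zero family_add family_scaleR uminus_square_summable_def algebra_simps)+
  show "u - v = u + - v" by (simp add: minus_square_summable_def)
qed

end

instantiation square_summable :: (type) real_inner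
begin

definition inner_square_summable :: "'a square_summable \<Rightarrow> 'a square_summable \<Rightarrow> real" where
  "u \<bullet> v = infsum (\<lambda>x. family u x \<bullet> family v x) UNIV"

definition norm_square_summable :: "'a square_summable \<Rightarrow> real" where
  "norm u = sqrt (u \<bullet> (u :: 'a square_summable))"

definition sgn_square_summable :: "'a square_summable \<Rightarrow> 'a square_summable" where
  "sgn u = inverse (norm u) *\<^sub>R (u :: 'a square_summable)"

definition dist_square_summable :: "'a square_summable \<Rightarrow> 'a square_summable \<Rightarrow> real" where
  "dist u v = norm (u - (v :: 'a square_summable))"

definition uniformity_square_summable :: "('a square_summable \<times> 'a square_summable) filter" where
  "uniformity = (INF e\<in>{0<..}. principal {(u, v). dist u (v :: 'a square_summable) < e})"

definition open_square_summable :: "'a square_summable set \<Rightarrow> bool" where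
  "open U = (\<forall>u\<in>U. \<forall>\<^sub>F (u', v) in uniformity. u' = (u :: 'a square_summable) \<longrightarrow> v \<in> U)"

instance
proof
  fix u v w :: "'a square_summable" and r :: real
  show "sgn u = u /\<^sub>R norm u" by (rule sgn_square_summable_def)
  show "dist u v = norm (u - v)" by (rule dist_square_summable_def)
  show "uniformity = (INF e\<in>{0<..}. principal {(u, v). dist u (v :: 'a square_summable) < e})"
    by (rule uniformity_square_summable_def)
  show "open U = (\<forall>u\<in>U. \<forall>\<^sub>F (u', v) in uniformity. u' = u \<longrightarrow> v \<in> U)" for U :: "'a square_summable set"
    by (rule open_square_summable_def)
  show "u \<bullet> v = v \<bullet> u" by (simp add: inner_square_summable_def inner_commute)
  show "(u + v) \<bullet> w = u \<bullet> w + v \<bullet> w"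
    unfolding inner_square_summable_def family_add inner_add_left
    by (intro infsum_add inner_summable_if_ell2) auto
  show "r *\<^sub>R u \<bullet> v = r * (u \<bullet> v)"
    unfolding inner_square_summable_def family_scaleR inner_scaleR_left
    by (intro infsum_cmult_right inner_summable_if_ell2) auto
  show "0 \<le> u \<bullet> u" unfolding inner_square_summable_def by (rule infsum_nonneg) simp
  show "u \<bullet> u = 0 \<longleftrightarrow> u = 0"
  proof
    assume "u \<bullet> u = 0"
    then have "family u x \<bullet> family u x = 0" for x
      using nonneg_infsum_le_0D[of "\<lambda>x. family u x \<bullet> family u x" UNIV x]
        inner_summable_if_ell2[of "family u" "family u"] by (simp add: inner_square_summable_def)
    then show "u = 0" by (intro family_eqI) (simp add: family_zero)
  qed (simp add: inner_square_summable_def family_zero)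
  show "norm u = sqrt (u \<bullet> u)" by (rule norm_square_summable_def)
qed

end

lemma norm_eq_ell2_norm: "norm u = ell2_norm (family u)"
  by (simp add: norm_square_summable_def inner_square_summable_def ell2_norm_def power2_norm_eq_inner)

lemma norm_squared_eq_infsum: "(norm u)\<^sup>2 = infsum (\<lambda>x. (cmod (family u x))\<^sup>2) UNIV"
  by (simp add: power2_norm_eq_inner inner_square_summable_def)

lemma finite_sum_le_norm_squared:
  assumes "finite F"
  shows "(\<Sum>x\<in>F. (cmod (family u x))\<^sup>2) \<le> (norm u)\<^sup>2"
  unfolding norm_squared_eq_infsum
  using family_in_ell2[of u] assms by (intro finite_sum_le_infsum) (auto simp: ell2_def)

lemma norm_squared_le_if_finite_sums_le:
  assumes "\<And>F. finite F \<Longrightarrow> (\<Sum>x\<in>F. (cmod (family u x))\<^sup>2) \<le> C"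
  shows "(norm u)\<^sup>2 \<le> C"
  unfolding norm_squared_eq_infsum
  using family_in_ell2[of u] assms by (intro infsum_le_finite_sums) (auto simp: ell2_def)

instance square_summable :: (type) complete_space
proof
  fix X :: "nat \<Rightarrow> 'a square_summable"
  assume X: "Cauchy X"
  have cmod_le: "cmod (family u x) \<le> norm u" for u :: "'a square_summable" and x
    using finite_sum_le_norm_squared[of "{x}" u] by (simp add: power2_le_iff_abs_le)
  have "Cauchy (\<lambda>n. family (X n) x)" for x
  proof (rule metric_CauchyI)
    fix e :: real assume "e > 0"
    from metric_CauchyD[OF X this] obtain N where N: "\<forall>m\<ge>N. \<forall>n\<ge>N. dist (X m) (X n) < e" by blast
    have "dist (family (X m) x) (family (X n) x) \<le> dist (X m) (X n)" for m n
      using cmod_le[of "X m - X n" x] by (simp add: dist_norm family_diff)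
    then show "\<exists>N. \<forall>m\<ge>N. \<forall>n\<ge>N. dist (family (X m) x) (family (X n) x) < e"
      using N by (meson order_le_less_trans)
  qed
  then have "\<forall>x. \<exists>l. (\<lambda>n. family (X n) x) \<longlonglongrightarrow> l"
    by (simp add: Cauchy_convergent_iff convergent_def)
  then obtain g where g: "\<And>x. (\<lambda>n. family (X n) x) \<longlonglongrightarrow> g x" by metis
  \<comment> \<open>the Cauchy condition passes to the pointwise limit on finite sets\<close>
  have tail: "(\<Sum>x\<in>F. (cmod (g x - family (X n) x))\<^sup>2) \<le> e\<^sup>2"
    if "\<And>m. m \<ge> N \<Longrightarrow> dist (X m) (X n) < e" "finite F" for e N n F
  proof (rule tendsto_upperbound)
    show "(\<lambda>m. \<Sum>x\<in>F. (cmod (family (X m) x - family (X n) x))\<^sup>2) \<longlonglongrightarrow> (\<Sum>x\<in>F. (cmod (g x - family (X n) x))\<^sup>2)"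
      by (intro tendsto_intros g)
    have "(\<Sum>x\<in>F. (cmod (family (X m) x - family (X n) x))\<^sup>2) \<le> e\<^sup>2" if "m \<ge> N" for m
    proof -
      have "(\<Sum>x\<in>F. (cmod (family (X m) x - family (X n) x))\<^sup>2) \<le> (dist (X m) (X n))\<^sup>2"
        using finite_sum_le_norm_squared[OF \<open>finite F\<close>, of "X m - X n"] by (simp add: family_diff dist_norm)
      also have "\<dots> \<le> e\<^sup>2" using \<open>\<And>m. m \<ge> N \<Longrightarrow> dist (X m) (X n) < e\<close>[OF that] by (intro power_mono) auto
      finally show ?thesis .
    qed
    then show "\<forall>\<^sub>F m in sequentially. (\<Sum>x\<in>F. (cmod (family (X m) x - family (X n) x))\<^sup>2) \<le> e\<^sup>2"
      by (auto simp: eventually_sequentially)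
  qed simp
  obtain N where N: "\<forall>m\<ge>N. \<forall>n\<ge>N. dist (X m) (X n) < 1"
    using metric_CauchyD[OF X, of 1] by auto
  have "(\<lambda>x. g x - family (X N) x) \<in> ell2"
    unfolding ell2_iff_bounded_finite_sums using tail[of N N 1] N by auto
  from add_in_ell2[OF this family_in_ell2[of "X N"]] have "g \<in> ell2" by simp
  define h where "h = square_summable g"
  have h: "family h = g" unfolding h_def by (rule square_summable_inverse) fact
  have "X \<longlonglongrightarrow> h"
  proof (rule metric_LIMSEQ_I)
    fix r :: real assume "r > 0"
    then obtain N where N: "\<forall>m\<ge>N. \<forall>n\<ge>N. dist (X m) (X n) < r / 2"
      using metric_CauchyD[OF X, of "r / 2"] by auto
    have "dist (X n) h < r" if "n \<ge> N" for n
    proof -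
      have "(norm (h - X n))\<^sup>2 \<le> (r / 2)\<^sup>2"
        by (intro norm_squared_le_if_finite_sums_le) (use tail[of N n "r / 2"] N that in \<open>auto simp: family_diff h\<close>)
      then have "norm (h - X n) \<le> r / 2" by (rule power2_le_imp_le) (use \<open>r > 0\<close> in simp)
      then show ?thesis using \<open>r > 0\<close> by (simp add: dist_norm norm_minus_commute)
    qed
    then show "\<exists>no. \<forall>n\<ge>no. dist (X n) h < r" by blast
  qed
  then show "convergent X" by (auto simp: convergent_def)
qed

section \<open>Weighted composition operators\<close>

definition bounded_weight :: "('x \<Rightarrow> real) \<Rightarrow> bool" where
  "bounded_weight w \<longleftrightarrow> (\<exists>K. \<forall>x. \<bar>w x\<bar> \<le> K)"

definition bounded_fibres :: "('x \<Rightarrow> 'y) \<Rightarrow> bool" where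
  "bounded_fibres \<pi> \<longleftrightarrow> (\<exists>n. \<forall>y. finite (\<pi> -` {y}) \<and> card (\<pi> -` {y}) \<le> n)"

lemma bounded_fibres_if_inj: "inj \<pi> \<Longrightarrow> bounded_fibres \<pi>"
  unfolding bounded_fibres_def
proof (intro exI allI conjI)
  fix y assume inj: "inj \<pi>"
  show "finite (\<pi> -` {y})" using inj by (intro finite_vimageI) auto
  show "card (\<pi> -` {y}) \<le> 1" using card_vimage_inj_on_le[OF inj, of "{y}"] by simp
qed

text \<open>
  Both the difference operators and the operators that act inside the period cells are finite sums
  of such operators; in the second case \<open>\<pi>\<close> is not injective, but has fibres of bounded size.
\<close>

definition weighted_composition ::
  "('x \<Rightarrow> real) \<Rightarrow> ('x \<Rightarrow> 'y) \<Rightarrow> 'y square_summable \<Rightarrow> 'x square_summable" where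
  "weighted_composition w \<pi> u = square_summable (\<lambda>x. w x *\<^sub>R family u (\<pi> x))"

text \<open>
  Each value of \<open>family u\<close> is used at most \<open>n\<close> times.
\<close>

lemma finite_sum_weighted_composition_le:
  assumes w: "\<And>x. \<bar>w x\<bar> \<le> K" and fibres: "\<And>y. finite (\<pi> -` {y}) \<and> card (\<pi> -` {y}) \<le> n"
    and F: "finite F"
  shows "(\<Sum>x\<in>F. (cmod (w x *\<^sub>R family u (\<pi> x)))\<^sup>2) \<le> K\<^sup>2 * real n * (norm u)\<^sup>2"
proof -
  have "(\<Sum>x\<in>F. (cmod (w x *\<^sub>R family u (\<pi> x)))\<^sup>2) \<le> (\<Sum>x\<in>F. K\<^sup>2 * (cmod (family u (\<pi> x)))\<^sup>2)"
  proof (rule sum_mono)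
    fix x
    have "(w x)\<^sup>2 \<le> K\<^sup>2" using power_mono[OF w[of x], of 2] by simp
    then show "(cmod (w x *\<^sub>R family u (\<pi> x)))\<^sup>2 \<le> K\<^sup>2 * (cmod (family u (\<pi> x)))\<^sup>2"
      by (simp add: power_mult_distrib mult_right_mono)
  qed
  also have "\<dots> = K\<^sup>2 * (\<Sum>y\<in>\<pi> ` F. \<Sum>x\<in>{x\<in>F. \<pi> x = y}. (cmod (family u (\<pi> x)))\<^sup>2)"
    unfolding sum_distrib_left[symmetric] by (subst sum.image_gen[OF F, of _ \<pi>]) simp
  also have "\<dots> \<le> K\<^sup>2 * (\<Sum>y\<in>\<pi> ` F. real n * (cmod (family u y))\<^sup>2)"
  proof (intro mult_left_mono sum_mono)
    fix y
    have "card {x\<in>F. \<pi> x = y} \<le> card (\<pi> -` {y})"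
      using fibres[of y] by (intro card_mono) auto
    then have "real (card {x\<in>F. \<pi> x = y}) \<le> real n" using fibres[of y] by linarith
    moreover have "(\<Sum>x\<in>{x\<in>F. \<pi> x = y}. (cmod (family u (\<pi> x)))\<^sup>2)
        = real (card {x\<in>F. \<pi> x = y}) * (cmod (family u y))\<^sup>2" by simp
    ultimately show "(\<Sum>x\<in>{x\<in>F. \<pi> x = y}. (cmod (family u (\<pi> x)))\<^sup>2) \<le> real n * (cmod (family u y))\<^sup>2"
      by (metis mult_right_mono zero_le_power2)
  qed simp
  also have "\<dots> \<le> K\<^sup>2 * (real n * (norm u)\<^sup>2)"
    unfolding sum_distrib_left[symmetric] using F
    by (intro mult_left_mono finite_sum_le_norm_squared) auto
  finally show ?thesis by (simp add: mult.assoc)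
qed

lemma family_weighted_composition:
  assumes "bounded_weight w" "bounded_fibres \<pi>"
  shows "family (weighted_composition w \<pi> u) x = w x *\<^sub>R family u (\<pi> x)"
proof -
  obtain K n where "\<And>x. \<bar>w x\<bar> \<le> K" "\<And>y. finite (\<pi> -` {y}) \<and> card (\<pi> -` {y}) \<le> n"
    using assms unfolding bounded_weight_def bounded_fibres_def by blast
  note bound = finite_sum_weighted_composition_le[where u=u, OF this]
  have "(\<lambda>x. w x *\<^sub>R family u (\<pi> x)) \<in> ell2"
    unfolding ell2_iff_bounded_finite_sums by (intro exI allI impI) (rule bound)
  then show ?thesis by (simp add: weighted_composition_def square_summable_inverse)
qed

lemma bounded_linear_weighted_composition:
  assumes "bounded_weight w" "bounded_fibres \<pi>"
  shows "bounded_linear (weighted_composition w \<pi>)"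
proof -
  obtain K n where Kn: "\<And>x. \<bar>w x\<bar> \<le> K" "\<And>y. finite (\<pi> -` {y}) \<and> card (\<pi> -` {y}) \<le> n"
    using assms unfolding bounded_weight_def bounded_fibres_def by blast
  have K: "K \<ge> 0" using Kn(1) by (meson abs_ge_zero order.trans)
  show ?thesis
  proof (rule bounded_linear_intro)
    show "weighted_composition w \<pi> (u + v) = weighted_composition w \<pi> u + weighted_composition w \<pi> v" for u v
      by (rule family_eqI) (simp add: family_weighted_composition[OF assms] family_add scaleR_add_right)
    show "weighted_composition w \<pi> (r *\<^sub>R u) = r *\<^sub>R weighted_composition w \<pi> u" for r u
      by (rule family_eqI) (simp add: family_weighted_composition[OF assms] family_scaleR mult.left_commute)
    show "norm (weighted_composition w \<pi> u) \<le> norm u * (K * sqrt (real n))" for u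
    proof (rule power2_le_imp_le)
      have "(norm (weighted_composition w \<pi> u))\<^sup>2 \<le> K\<^sup>2 * real n * (norm u)\<^sup>2"
        using finite_sum_weighted_composition_le[where u=u, OF Kn]
        by (intro norm_squared_le_if_finite_sums_le) (simp add: family_weighted_composition[OF assms])
      then show "(norm (weighted_composition w \<pi> u))\<^sup>2 \<le> (norm u * (K * sqrt (real n)))\<^sup>2"
        by (simp add: power_mult_distrib mult_ac)
    qed (use K in simp)
  qed
qed

text \<open>
  The adjoint of a weighted shift is the inverse shift with the transported weight, by the
  substitution \<open>y = \<pi> x\<close>.
\<close>

lemma inner_weighted_composition_left:
  assumes w: "bounded_weight w" and inv: "\<And>x. \<rho> (\<pi> x) = x" "\<And>y. \<pi> (\<rho> y) = y"
  shows "weighted_composition w \<pi> u \<bullet> v = u \<bullet> weighted_composition (w \<circ> \<rho>) \<rho> v"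
proof -
  have fib: "bounded_fibres \<pi>" "bounded_fibres \<rho>"
    by (rule bounded_fibres_if_inj[OF inj_on_inverseI[of UNIV \<rho> \<pi>]], simp add: inv, rule bounded_fibres_if_inj[OF inj_on_inverseI[of UNIV \<pi> \<rho>]], simp add: inv)
  have w': "bounded_weight (w \<circ> \<rho>)" using w by (auto simp: bounded_weight_def)
  have bij: "bij_betw \<pi> UNIV UNIV" by (rule bij_betwI[of _ _ _ \<rho>]) (simp_all add: inv)
  have "u \<bullet> weighted_composition (w \<circ> \<rho>) \<rho> v = (\<Sum>\<^sub>\<infinity>y. w (\<rho> y) * (family u y \<bullet> family v (\<rho> y)))"
    by (simp add: inner_square_summable_def family_weighted_composition w' fib)
  also have "\<dots> = (\<Sum>\<^sub>\<infinity>x. w x * (family u (\<pi> x) \<bullet> family v x))"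
    using infsum_reindex_bij_betw[OF bij, of "\<lambda>y. w (\<rho> y) * (family u y \<bullet> family v (\<rho> y))"] by (simp add: inv)
  also have "\<dots> = weighted_composition w \<pi> u \<bullet> v"
    by (simp add: inner_square_summable_def family_weighted_composition w fib)
  finally show ?thesis ..
qed

lemma bounded_weightI: "(\<And>x. \<bar>w x\<bar> \<le> K) \<Longrightarrow> bounded_weight w"
  by (auto simp: bounded_weight_def)

text \<open>
  The quadratic form of an edge of weight \<open>w\<close> between \<open>x\<close> and \<open>\<pi> x\<close> is dominated by \<open>\<bar>w\<bar>\<close> on
  the diagonal at both end points: summed over all edges, the left-hand side equals
  \<open>\<Sum> \<bar>w x\<bar> * (norm (family u x + sgn (w x) *\<^sub>R family u (\<pi> x)))\<^sup>2\<close>.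
\<close>

lemma edge_form_nonneg:
  fixes w :: "'x \<Rightarrow> real"
  assumes w: "bounded_weight w" and inv: "\<And>x. \<rho> (\<pi> x) = x" "\<And>y. \<pi> (\<rho> y) = y"
  shows "0 \<le> (weighted_composition w \<pi> u + weighted_composition (w \<circ> \<rho>) \<rho> u
     + weighted_composition (\<lambda>x. \<bar>w x\<bar> + \<bar>w (\<rho> x)\<bar>) (\<lambda>x. x) u) \<bullet> u"
proof -
  let ?f = "family u"
  have fib: "bounded_fibres \<pi>" "bounded_fibres \<rho>"
    by (rule bounded_fibres_if_inj[OF inj_on_inverseI[of UNIV \<rho> \<pi>]], simp add: inv, rule bounded_fibres_if_inj[OF inj_on_inverseI[of UNIV \<pi> \<rho>]], simp add: inv)
  have fib_id: "bounded_fibres (\<lambda>x :: 'x. x)" by (rule bounded_fibres_if_inj) simp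
  have bij: "bij_betw \<pi> UNIV UNIV" by (rule bij_betwI[of _ _ _ \<rho>]) (simp_all add: inv)
  obtain K where K: "\<And>x. \<bar>w x\<bar> \<le> K" using w unfolding bounded_weight_def by blast
  have "bounded_weight (\<lambda>x. \<bar>w x\<bar> + \<bar>w (\<rho> x)\<bar>)"
  proof (rule bounded_weightI)
    show "\<bar>\<bar>w x\<bar> + \<bar>w (\<rho> x)\<bar>\<bar> \<le> 2 * K" for x
      using K[of x] K[of "\<rho> x"] by linarith
  qed
  moreover have "bounded_weight (w \<circ> \<rho>)" "bounded_weight (\<lambda>x. \<bar>w x\<bar>)" "bounded_weight (\<lambda>x. \<bar>w (\<rho> x)\<bar>)"
    by (rule bounded_weightI[where K=K], simp add: K)+
  moreover have "bounded_weight (\<lambda>x::'x. 1)"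
    by (rule bounded_weightI[where K=1]) simp
  ultimately have wts: "bounded_weight (\<lambda>x. \<bar>w x\<bar> + \<bar>w (\<rho> x)\<bar>)" "bounded_weight (w \<circ> \<rho>)"
    "bounded_weight (\<lambda>x. \<bar>w x\<bar>)" "bounded_weight (\<lambda>x. \<bar>w (\<rho> x)\<bar>)" "bounded_weight (\<lambda>x::'x. 1)"
    by blast+
  have s1: "(\<lambda>x. w x * (?f (\<pi> x) \<bullet> ?f x)) summable_on UNIV"
    using inner_summable_if_ell2[of "family (weighted_composition w \<pi> u)" ?f]
    by (simp add: family_weighted_composition w fib)
  have s2: "(\<lambda>x. \<bar>w x\<bar> * (?f x \<bullet> ?f x)) summable_on UNIV"
    using inner_summable_if_ell2[of "family (weighted_composition (\<lambda>x. \<bar>w x\<bar>) (\<lambda>x. x) u)" ?f]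
    by (simp add: family_weighted_composition wts fib fib_id)
  have s3: "(\<lambda>x. \<bar>w x\<bar> * (?f (\<pi> x) \<bullet> ?f (\<pi> x))) summable_on UNIV"
    using inner_summable_if_ell2[of "family (weighted_composition (\<lambda>x. \<bar>w x\<bar>) \<pi> u)"
        "family (weighted_composition (\<lambda>x. 1) \<pi> u)"]
    by (simp add: family_weighted_composition wts fib fib_id)
  have e1: "weighted_composition w \<pi> u \<bullet> u = (\<Sum>\<^sub>\<infinity>x. w x * (?f (\<pi> x) \<bullet> ?f x))"
    by (simp add: inner_square_summable_def family_weighted_composition w fib)
  have e2: "weighted_composition (w \<circ> \<rho>) \<rho> u \<bullet> u = weighted_composition w \<pi> u \<bullet> u"
    using inner_weighted_composition_left[where u=u and v=u, OF w inv] by (simp add: inner_commute)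
  have "weighted_composition (\<lambda>x. \<bar>w x\<bar> + \<bar>w (\<rho> x)\<bar>) (\<lambda>x. x) u \<bullet> u
      = weighted_composition (\<lambda>x. \<bar>w x\<bar>) (\<lambda>x. x) u \<bullet> u + weighted_composition (\<lambda>x. \<bar>w (\<rho> x)\<bar>) (\<lambda>x. x) u \<bullet> u"
    unfolding inner_add_left[symmetric]
    by (intro arg_cong2[of _ _ _ _ "(\<bullet>)"] family_eqI)
      (simp_all add: family_weighted_composition wts fib fib_id family_add scaleR_add_left)
  also have "weighted_composition (\<lambda>x. \<bar>w x\<bar>) (\<lambda>x. x) u \<bullet> u = (\<Sum>\<^sub>\<infinity>x. \<bar>w x\<bar> * (?f x \<bullet> ?f x))"
    by (simp add: inner_square_summable_def family_weighted_composition wts fib fib_id)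
  also have "weighted_composition (\<lambda>x. \<bar>w (\<rho> x)\<bar>) (\<lambda>x. x) u \<bullet> u = (\<Sum>\<^sub>\<infinity>x. \<bar>w (\<rho> x)\<bar> * (?f x \<bullet> ?f x))"
    by (simp add: inner_square_summable_def family_weighted_composition wts fib fib_id)
  also have "\<dots> = (\<Sum>\<^sub>\<infinity>x. \<bar>w x\<bar> * (?f (\<pi> x) \<bullet> ?f (\<pi> x)))"
    using infsum_reindex_bij_betw[OF bij, of "\<lambda>x. \<bar>w (\<rho> x)\<bar> * (?f x \<bullet> ?f x)"] by (simp add: inv)
  finally have "(weighted_composition w \<pi> u + weighted_composition (w \<circ> \<rho>) \<rho> u
     + weighted_composition (\<lambda>x. \<bar>w x\<bar> + \<bar>w (\<rho> x)\<bar>) (\<lambda>x. x) u) \<bullet> u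
    = 2 * (\<Sum>\<^sub>\<infinity>x. w x * (?f (\<pi> x) \<bullet> ?f x)) + ((\<Sum>\<^sub>\<infinity>x. \<bar>w x\<bar> * (?f x \<bullet> ?f x))
       + (\<Sum>\<^sub>\<infinity>x. \<bar>w x\<bar> * (?f (\<pi> x) \<bullet> ?f (\<pi> x))))"
    by (simp add: inner_add_left e1 e2)
  also have "\<dots> = (\<Sum>\<^sub>\<infinity>x. 2 * (w x * (?f (\<pi> x) \<bullet> ?f x)) + (\<bar>w x\<bar> * (?f x \<bullet> ?f x) + \<bar>w x\<bar> * (?f (\<pi> x) \<bullet> ?f (\<pi> x))))"
    using s1 s2 s3 by (simp add: infsum_add infsum_cmult_right summable_on_add summable_on_cmult_right)
  also have "\<dots> \<ge> 0"
  proof (rule infsum_nonneg)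
    fix x
    have "0 \<le> \<bar>w x\<bar> * (norm (?f x + sgn (w x) *\<^sub>R ?f (\<pi> x)))\<^sup>2" by simp
    also have "\<dots> \<le> 2 * (w x * (?f (\<pi> x) \<bullet> ?f x)) + (\<bar>w x\<bar> * (?f x \<bullet> ?f x) + \<bar>w x\<bar> * (?f (\<pi> x) \<bullet> ?f (\<pi> x)))"
      unfolding power2_norm_eq_inner
      by (cases "w x" "0 :: real" rule: linorder_cases)
        (simp_all add: inner_add_left inner_add_right inner_diff_left inner_diff_right inner_commute algebra_simps)
    finally show "0 \<le> 2 * (w x * (?f (\<pi> x) \<bullet> ?f x)) + (\<bar>w x\<bar> * (?f x \<bullet> ?f x) + \<bar>w x\<bar> * (?f (\<pi> x) \<bullet> ?f (\<pi> x)))" .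
  qed
  finally show ?thesis .
qed

section \<open>Operators between block diagonal operators\<close>

text \<open>
  The set of all sites is the disjoint union of the cells \<open>\<phi> t ` I\<close>: every site \<open>z\<close> has a cell index
  \<open>\<tau> z\<close> and an offset \<open>r z\<close> in the reference cell \<open>I\<close>.
\<close>

locale tiling =
  fixes I :: "'x set" and \<phi> :: "'t \<Rightarrow> 'x \<Rightarrow> 'x" and \<tau> :: "'x \<Rightarrow> 't" and r :: "'x \<Rightarrow> 'x"
  assumes finite_I: "finite I" and r_in_I: "\<And>z. r z \<in> I" and position: "\<And>z. \<phi> (\<tau> z) (r z) = z"
    and cell_of: "\<And>t x. x \<in> I \<Longrightarrow> \<tau> (\<phi> t x) = t" and offset_in: "\<And>t x. x \<in> I \<Longrightarrow> r (\<phi> t x) = x"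
begin

lemma inner_eq_infsum_over_cells:
  "u \<bullet> v = (\<Sum>\<^sub>\<infinity>t. \<Sum>x\<in>I. family u (\<phi> t x) \<bullet> family v (\<phi> t x))"
  "(\<lambda>t. \<Sum>x\<in>I. family u (\<phi> t x) \<bullet> family v (\<phi> t x)) summable_on UNIV"
proof -
  let ?g = "\<lambda>z. family u z \<bullet> family v z"
  have bij: "bij_betw (\<lambda>(t, x). \<phi> t x) (UNIV \<times> I) UNIV"
    by (intro bij_betwI[of _ _ _ "\<lambda>z. (\<tau> z, r z)"]) (auto simp: r_in_I position cell_of offset_in)
  have eq: "(\<lambda>p. ?g ((\<lambda>(t, x). \<phi> t x) p)) = (\<lambda>(t, x). ?g (\<phi> t x))" by auto
  have g: "?g summable_on UNIV" by (intro inner_summable_if_ell2) auto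
  then have s: "(\<lambda>(t, x). ?g (\<phi> t x)) summable_on UNIV \<times> I"
    using summable_on_reindex_bij_betw[OF bij, of ?g] unfolding eq by simp
  have "u \<bullet> v = infsum (\<lambda>(t, x). ?g (\<phi> t x)) (UNIV \<times> I)"
    using infsum_reindex_bij_betw[OF bij, of ?g] unfolding eq by (simp add: inner_square_summable_def)
  also have "\<dots> = (\<Sum>\<^sub>\<infinity>t. \<Sum>\<^sub>\<infinity>x\<in>I. ?g (\<phi> t x))"
    using infsum_Sigma'_banach[OF s] by simp
  finally show "u \<bullet> v = (\<Sum>\<^sub>\<infinity>t. \<Sum>x\<in>I. ?g (\<phi> t x))" using finite_I by simp
  show "(\<lambda>t. \<Sum>x\<in>I. ?g (\<phi> t x)) summable_on UNIV"
    using summable_on_Sigma_banach[OF s] finite_I by simp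
qed

text \<open>
  The direct sum, over all cells, of copies of the matrix \<open>P\<close>.
\<close>

definition block :: "('x \<Rightarrow> 'x \<Rightarrow> real) \<Rightarrow> 'x square_summable \<Rightarrow> 'x square_summable" where
  "block P u = (\<Sum>y\<in>I. weighted_composition (\<lambda>z. P (r z) y) (\<lambda>z. \<phi> (\<tau> z) y) u)"

lemma block_components:
  assumes "y \<in> I"
  shows "bounded_weight (\<lambda>z. P (r z) y)" "bounded_fibres (\<lambda>z. \<phi> (\<tau> z) y)"
proof -
  have "\<bar>P (r z) y\<bar> \<le> (\<Sum>x\<in>I. \<bar>P x y\<bar>)" for z
    using finite_I r_in_I by (intro member_le_sum[where f="\<lambda>x. \<bar>P x y\<bar>"]) auto
  then show "bounded_weight (\<lambda>z. P (r z) y)" by (auto simp: bounded_weight_def)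
  have sub: "(\<lambda>z. \<phi> (\<tau> z) y) -` {x} \<subseteq> \<phi> (\<tau> x) ` I" for x
  proof
    fix z assume "z \<in> (\<lambda>z. \<phi> (\<tau> z) y) -` {x}"
    then have "\<tau> z = \<tau> x" using cell_of[OF assms, of "\<tau> z"] by simp
    then show "z \<in> \<phi> (\<tau> x) ` I" using position[of z] r_in_I[of z] by (metis imageI)
  qed
  show "bounded_fibres (\<lambda>z. \<phi> (\<tau> z) y)"
    unfolding bounded_fibres_def
  proof (intro exI allI conjI)
    fix x
    show "finite ((\<lambda>z. \<phi> (\<tau> z) y) -` {x})"
      using sub by (rule finite_subset) (use finite_I in simp)
    have "card ((\<lambda>z. \<phi> (\<tau> z) y) -` {x}) \<le> card (\<phi> (\<tau> x) ` I)"
      using sub finite_I by (intro card_mono) auto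
    also have "\<dots> \<le> card I" using finite_I by (rule card_image_le)
    finally show "card ((\<lambda>z. \<phi> (\<tau> z) y) -` {x}) \<le> card I" .
  qed
qed

lemma bounded_linear_block: "bounded_linear (block P)"
  unfolding block_def
  by (intro bounded_linear_sum bounded_linear_weighted_composition block_components)

lemma family_sum: "family (\<Sum>y\<in>J. f y) z = (\<Sum>y\<in>J. family (f y) z)"
  by (induction J rule: infinite_finite_induct) (simp_all add: family_zero family_add)

lemma family_block:
  "x \<in> I \<Longrightarrow> family (block P u) (\<phi> t x) = (\<Sum>y\<in>I. P x y *\<^sub>R family u (\<phi> t y))"
  unfolding block_def family_sum
  by (intro sum.cong) (simp_all add: family_weighted_composition block_components cell_of offset_in)

lemma eq_block_if_cellwise:
  assumes "\<And>t x. x \<in> I \<Longrightarrow> family v (\<phi> t x) = (\<Sum>y\<in>I. P x y *\<^sub>R family u (\<phi> t y))"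
  shows "v = block P u"
proof (rule family_eqI)
  fix z
  show "family v z = family (block P u) z"
    using assms[of "r z" "\<tau> z"] family_block[of "r z" P u "\<tau> z"] by (simp add: r_in_I position)
qed

lemma block_form:
  "block A v \<bullet> v = (\<Sum>\<^sub>\<infinity>t. form_on I A (\<lambda>x. Re (family v (\<phi> t x))) (\<lambda>x. Re (family v (\<phi> t x)))
      + form_on I A (\<lambda>x. Im (family v (\<phi> t x))) (\<lambda>x. Im (family v (\<phi> t x))))"
  "(\<lambda>t. form_on I A (\<lambda>x. Re (family v (\<phi> t x))) (\<lambda>x. Re (family v (\<phi> t x)))
      + form_on I A (\<lambda>x. Im (family v (\<phi> t x))) (\<lambda>x. Im (family v (\<phi> t x)))) summable_on UNIV"
proof -
  have "(\<Sum>x\<in>I. family (block A v) (\<phi> t x) \<bullet> family v (\<phi> t x))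
    = form_on I A (\<lambda>x. Re (family v (\<phi> t x))) (\<lambda>x. Re (family v (\<phi> t x)))
      + form_on I A (\<lambda>x. Im (family v (\<phi> t x))) (\<lambda>x. Im (family v (\<phi> t x)))" for t
    unfolding form_on_def sum.distrib[symmetric]
    by (intro sum.cong refl)
      (simp add: family_block inner_sum_left inner_complex_def sum_distrib_left sum.distrib algebra_simps)
  then show
    "block A v \<bullet> v = (\<Sum>\<^sub>\<infinity>t. form_on I A (\<lambda>x. Re (family v (\<phi> t x))) (\<lambda>x. Re (family v (\<phi> t x)))
      + form_on I A (\<lambda>x. Im (family v (\<phi> t x))) (\<lambda>x. Im (family v (\<phi> t x))))"
    "(\<lambda>t. form_on I A (\<lambda>x. Re (family v (\<phi> t x))) (\<lambda>x. Re (family v (\<phi> t x)))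
      + form_on I A (\<lambda>x. Im (family v (\<phi> t x))) (\<lambda>x. Im (family v (\<phi> t x)))) summable_on UNIV"
    using inner_eq_infsum_over_cells[of "block A v" v] by simp_all
qed

lemma norm_squared_eq_infsum_over_cells:
  "(norm v)\<^sup>2 = (\<Sum>\<^sub>\<infinity>t. dot_on I (\<lambda>x. Re (family v (\<phi> t x))) (\<lambda>x. Re (family v (\<phi> t x)))
      + dot_on I (\<lambda>x. Im (family v (\<phi> t x))) (\<lambda>x. Im (family v (\<phi> t x))))"
  "(\<lambda>t. dot_on I (\<lambda>x. Re (family v (\<phi> t x))) (\<lambda>x. Re (family v (\<phi> t x)))
      + dot_on I (\<lambda>x. Im (family v (\<phi> t x))) (\<lambda>x. Im (family v (\<phi> t x)))) summable_on UNIV"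
proof -
  have "(\<Sum>x\<in>I. family v (\<phi> t x) \<bullet> family v (\<phi> t x))
    = dot_on I (\<lambda>x. Re (family v (\<phi> t x))) (\<lambda>x. Re (family v (\<phi> t x)))
      + dot_on I (\<lambda>x. Im (family v (\<phi> t x))) (\<lambda>x. Im (family v (\<phi> t x)))" for t
    unfolding dot_on_def sum.distrib[symmetric] by (simp add: inner_complex_def)
  then show "(norm v)\<^sup>2 = (\<Sum>\<^sub>\<infinity>t. dot_on I (\<lambda>x. Re (family v (\<phi> t x))) (\<lambda>x. Re (family v (\<phi> t x)))
      + dot_on I (\<lambda>x. Im (family v (\<phi> t x))) (\<lambda>x. Im (family v (\<phi> t x))))"
    "(\<lambda>t. dot_on I (\<lambda>x. Re (family v (\<phi> t x))) (\<lambda>x. Re (family v (\<phi> t x)))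
      + dot_on I (\<lambda>x. Im (family v (\<phi> t x))) (\<lambda>x. Im (family v (\<phi> t x)))) summable_on UNIV"
    using inner_eq_infsum_over_cells[of v v] by (simp_all add: power2_norm_eq_inner)
qed

text \<open>
  The matrices are real and the families complex; a real quadratic form at a complex vector is the
  sum of its values at the real and imaginary parts.
\<close>

lemma block_form_mono:
  assumes "\<And>t g. g \<in> {Re, Im} \<Longrightarrow> form_on I A (\<lambda>x. g (family v (\<phi> t x))) (\<lambda>x. g (family v (\<phi> t x)))
      \<le> c * dot_on I (\<lambda>x. g (family v (\<phi> t x))) (\<lambda>x. g (family v (\<phi> t x)))"
  shows "block A v \<bullet> v \<le> c * (norm v)\<^sup>2"
proof -
  have "block A v \<bullet> v \<le> (\<Sum>\<^sub>\<infinity>t. c * (dot_on I (\<lambda>x. Re (family v (\<phi> t x))) (\<lambda>x. Re (family v (\<phi> t x)))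
      + dot_on I (\<lambda>x. Im (family v (\<phi> t x))) (\<lambda>x. Im (family v (\<phi> t x)))))"
    unfolding block_form(1)
  proof (rule infsum_mono)
    fix t
    show "form_on I A (\<lambda>x. Re (family v (\<phi> t x))) (\<lambda>x. Re (family v (\<phi> t x)))
      + form_on I A (\<lambda>x. Im (family v (\<phi> t x))) (\<lambda>x. Im (family v (\<phi> t x)))
      \<le> c * (dot_on I (\<lambda>x. Re (family v (\<phi> t x))) (\<lambda>x. Re (family v (\<phi> t x)))
      + dot_on I (\<lambda>x. Im (family v (\<phi> t x))) (\<lambda>x. Im (family v (\<phi> t x))))"
      unfolding distrib_left by (intro add_mono assms) auto
  qed (intro block_form(2) summable_on_cmult_right norm_squared_eq_infsum_over_cells(2))+
  also have "\<dots> = c * (norm v)\<^sup>2"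
    unfolding norm_squared_eq_infsum_over_cells(1)
    by (intro infsum_cmult_right norm_squared_eq_infsum_over_cells(2))
  finally show ?thesis .
qed

lemma form_on_uminus: "form_on I (\<lambda>x y. - A x y) u v = - form_on I A u v"
  by (simp add: form_on_def sum_negf)

lemma block_uminus: "block (\<lambda>x y. - A x y) u = - block A u"
  by (rule eq_block_if_cellwise[symmetric])
    (use family_diff[of 0 "block A u"] in \<open>simp add: family_zero family_block sum_negf\<close>)

text \<open>
  If \<open>L\<close> lies between two block diagonal operators, then its spectrum lies in the union of the
  intervals between corresponding eigenvalues of the two blocks: off these intervals, the
  finite-dimensional splitting of the reference cell, repeated in each cell, makes \<open>L - l\<close> definite
  with opposite signs on two complementary spaces. Measurability holds because the spectrum is
  compact.
\<close>

lemma spectrum_measure_le_trace: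
  fixes L :: "'x square_summable \<Rightarrow> 'x square_summable"
  assumes L: "bounded_linear L" and sym: "\<And>u v. L u \<bullet> v = u \<bullet> L v"
    and symA: "\<forall>x\<in>I. \<forall>y\<in>I. A x y = A y x" and symB: "\<forall>x\<in>I. \<forall>y\<in>I. B x y = B y x"
    and AB: "\<And>h. form_on I A h h \<le> form_on I B h h"
    and lower: "\<And>u. block A u \<bullet> u \<le> L u \<bullet> u" and upper: "\<And>u. L u \<bullet> u \<le> block B u \<bullet> u"
  defines "S \<equiv> {l. \<not> boundedly_invertible (\<lambda>u. L u - l *\<^sub>R u)}"
  shows "S \<in> lmeasurable \<and> measure lebesgue S \<le> (\<Sum>x\<in>I. B x x - A x x)"
proof -
  show ?thesis
    using eigenvalue_intervals_and_gap_splitting[OF finite_I symA symB AB]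
  proof (elim exE conjE)
    fix \<mu> \<nu> :: "nat \<Rightarrow> real"
    assume \<mu>\<nu>: "\<forall>j<card I. \<mu> j \<le> \<nu> j"
      "(\<Sum>j<card I. \<nu> j - \<mu> j) = (\<Sum>x\<in>I. B x x - A x x)"
      and gap: "\<forall>l. (\<forall>j<card I. l \<notin> {\<mu> j..\<nu> j}) \<longrightarrow> (\<exists>P \<epsilon>. \<epsilon> > 0 \<and>
         (\<forall>u. let v = (\<lambda>x. \<Sum>y\<in>I. P x y * u y); w = (\<lambda>x. u x - v x) in
            form_on I B v v \<le> (l - \<epsilon>) * dot_on I v v \<and> (l + \<epsilon>) * dot_on I w w \<le> form_on I A w w))"
    have invertible: "boundedly_invertible (\<lambda>u. L u - l *\<^sub>R u)"
      if l: "\<And>j. j < card I \<Longrightarrow> l \<notin> {\<mu> j..\<nu> j}" for l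
    proof -
      have "\<forall>j<card I. l \<notin> {\<mu> j..\<nu> j}" using l by blast
      note ex = mp[OF spec[OF gap] this]
      obtain P \<epsilon> where "\<epsilon> > 0" and split:
        "\<forall>h. let v = (\<lambda>x. \<Sum>y\<in>I. P x y * h y); w = (\<lambda>x. h x - v x) in
            form_on I B v v \<le> (l - \<epsilon>) * dot_on I v v \<and> (l + \<epsilon>) * dot_on I w w \<le> form_on I A w w"
        using ex by (elim exE conjE)
      have Pu: "g (family (block P u) (\<phi> t x)) = (\<Sum>y\<in>I. P x y * g (family u (\<phi> t y)))"
        if "x \<in> I" "g \<in> {Re, Im}" for g u t x
        using that by (auto simp: family_block)
      have V: "block B (block P u) \<bullet> block P u \<le> (l - \<epsilon>) * (norm (block P u))\<^sup>2" for u
      proof (rule block_form_mono)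
        fix t and g :: "complex \<Rightarrow> real" assume g: "g \<in> {Re, Im}"
        let ?v = "\<lambda>x. \<Sum>y\<in>I. P x y * g (family u (\<phi> t y))"
        have "form_on I B ?v ?v \<le> (l - \<epsilon>) * dot_on I ?v ?v"
          using split[rule_format, of "\<lambda>y. g (family u (\<phi> t y))"] by (simp add: Let_def)
        then show "form_on I B (\<lambda>x. g (family (block P u) (\<phi> t x))) (\<lambda>x. g (family (block P u) (\<phi> t x)))
           \<le> (l - \<epsilon>) * dot_on I (\<lambda>x. g (family (block P u) (\<phi> t x))) (\<lambda>x. g (family (block P u) (\<phi> t x)))"
          using form_on_cong[of I "\<lambda>x. g (family (block P u) (\<phi> t x))" ?v "\<lambda>x. g (family (block P u) (\<phi> t x))" ?v B]
            dot_on_cong[of I "\<lambda>x. g (family (block P u) (\<phi> t x))" ?v "\<lambda>x. g (family (block P u) (\<phi> t x))" ?v] Pu[OF _ g]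
          by simp
      qed
      have W: "(l + \<epsilon>) * (norm (u - block P u))\<^sup>2 \<le> block A (u - block P u) \<bullet> (u - block P u)" for u
      proof -
        let ?d = "u - block P u"
        have "block (\<lambda>x y. - A x y) ?d \<bullet> ?d \<le> - (l + \<epsilon>) * (norm ?d)\<^sup>2"
        proof (rule block_form_mono)
          fix t and g :: "complex \<Rightarrow> real" assume g: "g \<in> {Re, Im}"
          let ?w = "\<lambda>x. g (family u (\<phi> t x)) - (\<Sum>y\<in>I. P x y * g (family u (\<phi> t y)))"
          have "(l + \<epsilon>) * dot_on I ?w ?w \<le> form_on I A ?w ?w"
            using split[rule_format, of "\<lambda>y. g (family u (\<phi> t y))"] by (simp add: Let_def)
          moreover have "g (family ?d (\<phi> t x)) = ?w x" if "x \<in> I" for x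
            using g Pu[OF that g, of u t] by (auto simp: family_diff)
          then have "form_on I A (\<lambda>x. g (family ?d (\<phi> t x))) (\<lambda>x. g (family ?d (\<phi> t x))) = form_on I A ?w ?w"
            "dot_on I (\<lambda>x. g (family ?d (\<phi> t x))) (\<lambda>x. g (family ?d (\<phi> t x))) = dot_on I ?w ?w"
            by (intro form_on_cong dot_on_cong; simp)+
          ultimately show "form_on I (\<lambda>x y. - A x y) (\<lambda>x. g (family ?d (\<phi> t x))) (\<lambda>x. g (family ?d (\<phi> t x)))
            \<le> - (l + \<epsilon>) * dot_on I (\<lambda>x. g (family ?d (\<phi> t x))) (\<lambda>x. g (family ?d (\<phi> t x)))"
            unfolding form_on_uminus mult_minus_left neg_le_iff_le by (simp only:)
        qed
        then show ?thesis by (simp add: block_uminus algebra_simps)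
      qed
      show ?thesis
      proof (rule boundedly_invertible_if_definite_splitting)
        show "bounded_linear (\<lambda>u. L u - l *\<^sub>R u)"
          by (intro bounded_linear_sub L bounded_linear_scaleR_right)
        show "bounded_linear (block P)" by (rule bounded_linear_block)
        show "(L u - l *\<^sub>R u) \<bullet> v = u \<bullet> (L v - l *\<^sub>R v)" for u v
          by (simp add: inner_diff_left inner_diff_right sym)
        show "\<epsilon> > 0" by fact
        show "(L (block P u) - l *\<^sub>R block P u) \<bullet> block P u \<le> - \<epsilon> * (norm (block P u))\<^sup>2" for u
          using upper[of "block P u"] V[of u]
          by (simp add: inner_diff_left power2_norm_eq_inner algebra_simps)
        show "\<epsilon> * (norm (u - block P u))\<^sup>2
            \<le> (L (u - block P u) - l *\<^sub>R (u - block P u)) \<bullet> (u - block P u)" for u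
        proof -
          define d where "d = u - block P u"
          show ?thesis using lower[of d] W[of u] unfolding d_def[symmetric]
            by (simp add: inner_diff_left power2_norm_eq_inner algebra_simps)
        qed
      qed
    qed
    have sub: "S \<subseteq> (\<Union>j\<in>{..<card I}. {\<mu> j..\<nu> j})"
      using invertible unfolding S_def by blast
    have closed: "closed S" unfolding S_def by (rule closed_real_spectrum_of_bounded_linear[OF L])
    have meas: "(\<Union>j\<in>{..<card I}. {\<mu> j..\<nu> j}) \<in> lmeasurable"
      by (intro fmeasurable.finite_UN) auto
    have "bounded S" using sub by (rule bounded_subset[rotated]) auto
    then have S: "S \<in> lmeasurable"
      using closed by (intro lmeasurable_compact) (simp add: compact_eq_bounded_closed)
    have "measure lebesgue S \<le> measure lebesgue (\<Union>j\<in>{..<card I}. {\<mu> j..\<nu> j})"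
      using sub S meas by (intro measure_mono_fmeasurable) auto
    also have "\<dots> \<le> (\<Sum>j<card I. measure lebesgue {\<mu> j..\<nu> j})"
      by (intro measure_UNION_le) auto
    also have "\<dots> = (\<Sum>j<card I. \<nu> j - \<mu> j)"
      using \<mu>\<nu>(1) by (intro sum.cong) auto
    finally show ?thesis using S \<mu>\<nu>(2) by simp
  qed
qed

end

section \<open>Difference operators on the lattice\<close>

text \<open>
  Every square-summable family comes from a unique point of the Hilbert space type, so \<open>T - l\<close> is
  bijective on these families iff \<open>L - l\<close> is bijective, and a bound for \<open>inv_into\<close> is a lower bound
  for \<open>L - l\<close>.
\<close>

lemma real_spectrum_eq_not_boundedly_invertible:
  fixes L :: "'i square_summable \<Rightarrow> 'i square_summable"
  assumes L: "linear L" and T: "\<And>u. T (family u) = family (L u)"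
  shows "real_spectrum T = {l. \<not> boundedly_invertible (\<lambda>u. L u - l *\<^sub>R u)}"
proof -
  have "complex_of_real l \<in> resolvent_set T \<longleftrightarrow> boundedly_invertible (\<lambda>u. L u - l *\<^sub>R u)" for l
  proof -
    define S where "S = shifted_op T (complex_of_real l)"
    define Q where "Q u = L u - l *\<^sub>R u" for u
    have S: "S (family u) = family (Q u)" for u
      by (simp add: S_def Q_def shifted_op_def T fun_eq_iff family_diff family_scaleR scaleR_conv_of_real)
    have Q_diff: "Q (u - v) = Q u - Q v" for u v
      by (simp add: Q_def linear_diff[OF L] scaleR_diff_right)
    have ell2E: "\<exists>u. v = family u" if "v \<in> ell2" for v :: "'i \<Rightarrow> complex"
      using square_summable_inverse[OF that] by metis
    have "(bij_betw S ell2 ell2 \<and> (\<exists>C. \<forall>v\<in>ell2. ell2_norm (inv_into ell2 S v) \<le> C * ell2_norm v))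
        \<longleftrightarrow> boundedly_invertible Q"
    proof
      assume "bij_betw S ell2 ell2 \<and> (\<exists>C. \<forall>v\<in>ell2. ell2_norm (inv_into ell2 S v) \<le> C * ell2_norm v)"
      then obtain C where bij: "bij_betw S ell2 ell2"
        and C: "\<forall>v\<in>ell2. ell2_norm (inv_into ell2 S v) \<le> C * ell2_norm v" by blast
      have "\<exists>u. f = Q u" for f
      proof -
        have "family f \<in> S ` ell2" using bij by (simp add: bij_betw_def)
        then obtain v where "v \<in> ell2" "family f = S v" by blast
        then show ?thesis using ell2E S by (metis family_inject)
      qed
      moreover have "norm u \<le> C * norm (Q u)" for u
      proof -
        have "inv_into ell2 S (S (family u)) = family u"
          using bij by (intro inv_into_f_f) (auto simp: bij_betw_def)
        then show ?thesis using C[rule_format, of "family (Q u)"] by (simp add: S norm_eq_ell2_norm)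
      qed
      ultimately show "boundedly_invertible Q" unfolding boundedly_invertible_def surj_def by blast
    next
      assume inv: "boundedly_invertible Q"
      then obtain C where surj: "surj Q" and C: "\<And>u. norm u \<le> C * norm (Q u)"
        by (auto simp: boundedly_invertible_def)
      have inj: "inj_on S ell2"
      proof (rule inj_onI)
        fix v w :: "'i \<Rightarrow> complex" assume "v \<in> ell2" "w \<in> ell2" "S v = S w"
        moreover obtain u u' where "v = family u" "w = family u'"
          using ell2E \<open>v \<in> ell2\<close> \<open>w \<in> ell2\<close> by metis
        ultimately have "Q u = Q u'" by (simp add: S family_inject)
        then show "v = w" using C[of "u - u'"] \<open>v = _\<close> \<open>w = _\<close> by (simp add: Q_diff)
      qed
      have "S ` ell2 = ell2"
      proof (intro equalityI subsetI)
        fix v assume "v \<in> S ` ell2"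
        then show "v \<in> ell2" using ell2E S by (metis family_in_ell2 imageE)
      next
        fix v :: "'i \<Rightarrow> complex" assume "v \<in> ell2"
        then obtain f where "v = family f" using ell2E by blast
        moreover obtain u where "f = Q u" using surj by (metis surjD)
        ultimately show "v \<in> S ` ell2" using S[of u] by (metis family_in_ell2 image_eqI)
      qed
      then have bij: "bij_betw S ell2 ell2" using inj by (simp add: bij_betw_def)
      have "ell2_norm (inv_into ell2 S v) \<le> C * ell2_norm v" if v: "v \<in> ell2" for v
      proof -
        obtain f where f: "v = family f" using ell2E v by blast
        obtain u where u: "f = Q u" using surj by (metis surjD)
        have "inv_into ell2 S (S (family u)) = family u" using inj by (intro inv_into_f_f) auto
        then show ?thesis using C[of u] by (simp add: S f u norm_eq_ell2_norm)
      qed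
      then show "bij_betw S ell2 ell2 \<and> (\<exists>C. \<forall>v\<in>ell2. ell2_norm (inv_into ell2 S v) \<le> C * ell2_norm v)"
        using bij by blast
    qed
    then show ?thesis unfolding resolvent_set_def S_def Q_def by simp
  qed
  then show ?thesis by (auto simp: real_spectrum_def spectrum_def)
qed

definition shift :: "int \<Rightarrow> int \<Rightarrow> int \<times> int \<Rightarrow> int \<times> int" where
  "shift s t = (\<lambda>(i, k). (i + s, k + t))"

lemma shift_Pair [simp]: "shift s t (i, k) = (i + s, k + t)"
  by (simp add: shift_def)

lemma shift_inverse:
  "shift (-1) 0 (shift 1 0 x) = x" "shift 1 0 (shift (-1) 0 x) = x"
  "shift 0 (-1) (shift 0 1 x) = x" "shift 0 1 (shift 0 (-1) x) = x"
  by (cases x; simp)+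

lemma bounded_fibres_shift: "bounded_fibres (shift s t)" "bounded_fibres (\<lambda>x. x)"
  by (rule bounded_fibres_if_inj; auto simp: inj_def)+

text \<open>
  The difference operator with each weighted shift next to its adjoint, the inverse shift with
  transported weight; this form shows symmetry and matches the edge forms.
\<close>

definition lattice_op ::
  "(int \<Rightarrow> int \<Rightarrow> real) \<Rightarrow> (int \<Rightarrow> int \<Rightarrow> real) \<Rightarrow> (int \<Rightarrow> int \<Rightarrow> real)
    \<Rightarrow> (int \<times> int) square_summable \<Rightarrow> (int \<times> int) square_summable" where
  "lattice_op a b c u =
     weighted_composition (case_prod a) (shift 1 0) u
   + weighted_composition (case_prod a \<circ> shift (-1) 0) (shift (-1) 0) u
   + weighted_composition (case_prod b) (shift 0 1) u
   + weighted_composition (case_prod b \<circ> shift 0 (-1)) (shift 0 (-1)) u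
   + weighted_composition (case_prod c) (\<lambda>x. x) u"

lemma bounded_weight_comp: "bounded_weight w \<Longrightarrow> bounded_weight (w \<circ> f)"
  by (auto simp: bounded_weight_def)

lemma bounded_weight_sum:
  assumes "bounded_weight v" "bounded_weight w"
  shows "bounded_weight (\<lambda>x. v x + w x)"
proof -
  obtain K M where "\<And>x. \<bar>v x\<bar> \<le> K" "\<And>x. \<bar>w x\<bar> \<le> M" using assms by (auto simp: bounded_weight_def)
  then have "\<bar>v x + w x\<bar> \<le> K + M" for x
    by (meson abs_triangle_ineq add_mono order.trans)
  then show ?thesis by (rule bounded_weightI)
qed

context
  fixes a b c :: "int \<Rightarrow> int \<Rightarrow> real"
  assumes bounded: "bounded_weight (case_prod a)" "bounded_weight (case_prod b)" "bounded_weight (case_prod c)"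
begin

lemma family_lattice_op: "family (lattice_op a b c u) = difference_op a b c (family u)"
  by (auto simp: lattice_op_def difference_op_def family_add family_weighted_composition bounded
      bounded_weight_comp bounded_fibres_shift scaleR_conv_of_real fun_eq_iff)

lemma bounded_linear_lattice_op: "bounded_linear (lattice_op a b c)"
  unfolding lattice_op_def
  by (intro bounded_linear_add bounded_linear_weighted_composition bounded bounded_weight_comp bounded_fibres_shift)

lemma lattice_op_symmetric: "lattice_op a b c u \<bullet> v = u \<bullet> lattice_op a b c v"
proof -
  have w: "w \<circ> shift (-1) 0 \<circ> shift 1 0 = w" "w \<circ> shift 0 (-1) \<circ> shift 0 1 = w" for w :: "int \<times> int \<Rightarrow> real"
    by (simp_all add: fun_eq_iff shift_inverse)
  have "weighted_composition (case_prod a) (shift 1 0) u \<bullet> v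
      = u \<bullet> weighted_composition (case_prod a \<circ> shift (-1) 0) (shift (-1) 0) v"
    by (rule inner_weighted_composition_left[OF bounded(1) shift_inverse(1,2)])
  moreover have "weighted_composition (case_prod a \<circ> shift (-1) 0) (shift (-1) 0) u \<bullet> v
      = u \<bullet> weighted_composition (case_prod a) (shift 1 0) v"
    by (subst inner_weighted_composition_left[OF bounded_weight_comp[OF bounded(1)] shift_inverse(2,1)]) (simp only: w)
  moreover have "weighted_composition (case_prod b) (shift 0 1) u \<bullet> v
      = u \<bullet> weighted_composition (case_prod b \<circ> shift 0 (-1)) (shift 0 (-1)) v"
    by (rule inner_weighted_composition_left[OF bounded(2) shift_inverse(3,4)])
  moreover have "weighted_composition (case_prod b \<circ> shift 0 (-1)) (shift 0 (-1)) u \<bullet> v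
      = u \<bullet> weighted_composition (case_prod b) (shift 0 1) v"
    by (subst inner_weighted_composition_left[OF bounded_weight_comp[OF bounded(2)] shift_inverse(4,3)]) (simp only: w)
  moreover have "weighted_composition (case_prod c) (\<lambda>x. x) u \<bullet> v = u \<bullet> weighted_composition (case_prod c) (\<lambda>x. x) v"
    using inner_weighted_composition_left[OF bounded(3), of "\<lambda>x. x" "\<lambda>x. x" u v] by (simp add: comp_def)
  ultimately show ?thesis
    unfolding lattice_op_def inner_add_left inner_add_right by linarith
qed

end

text \<open>
  The weighted degree of a site in the lattice graph. With it on the diagonal, a difference operator
  is a signed graph Laplacian and hence nonnegative.
\<close>

definition edge_degree :: "(int \<Rightarrow> int \<Rightarrow> real) \<Rightarrow> (int \<Rightarrow> int \<Rightarrow> real) \<Rightarrow> int \<Rightarrow> int \<Rightarrow> real" where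
  "edge_degree a b i k = \<bar>a i k\<bar> + \<bar>a (i - 1) k\<bar> + (\<bar>b i k\<bar> + \<bar>b i (k - 1)\<bar>)"

lemma bounded_weight_abs: "bounded_weight w \<Longrightarrow> bounded_weight (\<lambda>x. \<bar>w x\<bar>)"
  by (simp add: bounded_weight_def)

lemma case_prod_edge_degree:
  "case_prod (edge_degree a b) = (\<lambda>x. (\<bar>case_prod a x\<bar> + \<bar>case_prod a (shift (-1) 0 x)\<bar>)
      + (\<bar>case_prod b x\<bar> + \<bar>case_prod b (shift 0 (-1) x)\<bar>))"
  by (auto simp: edge_degree_def fun_eq_iff)

lemma bounded_weight_edge_degree:
  assumes "bounded_weight (case_prod a)" "bounded_weight (case_prod b)"
  shows "bounded_weight (case_prod (edge_degree a b))"
  unfolding case_prod_edge_degree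
  using bounded_weight_comp[OF assms(1), of "shift (-1) 0"] bounded_weight_comp[OF assms(2), of "shift 0 (-1)"]
  by (intro bounded_weight_sum bounded_weight_abs assms) (simp_all add: comp_def)

lemma lattice_op_edge_degree_nonneg:
  assumes a: "bounded_weight (case_prod a)" and b: "bounded_weight (case_prod b)"
  shows "0 \<le> lattice_op a b (edge_degree a b) u \<bullet> u"
proof -
  have wts: "bounded_weight (\<lambda>x. \<bar>case_prod a x\<bar> + \<bar>case_prod a (shift (-1) 0 x)\<bar>)"
    "bounded_weight (\<lambda>x. \<bar>case_prod b x\<bar> + \<bar>case_prod b (shift 0 (-1) x)\<bar>)"
    using bounded_weight_comp[OF a, of "shift (-1) 0"] bounded_weight_comp[OF b, of "shift 0 (-1)"]
    by (intro bounded_weight_sum bounded_weight_abs a b; simp add: comp_def)+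
  have split: "weighted_composition (case_prod (edge_degree a b)) (\<lambda>x. x) u
      = weighted_composition (\<lambda>x. \<bar>case_prod a x\<bar> + \<bar>case_prod a (shift (-1) 0 x)\<bar>) (\<lambda>x. x) u
      + weighted_composition (\<lambda>x. \<bar>case_prod b x\<bar> + \<bar>case_prod b (shift 0 (-1) x)\<bar>) (\<lambda>x. x) u"
  proof (rule family_eqI)
    fix x
    show "family (weighted_composition (case_prod (edge_degree a b)) (\<lambda>x. x) u) x
      = family (weighted_composition (\<lambda>x. \<bar>case_prod a x\<bar> + \<bar>case_prod a (shift (-1) 0 x)\<bar>) (\<lambda>x. x) u
      + weighted_composition (\<lambda>x. \<bar>case_prod b x\<bar> + \<bar>case_prod b (shift 0 (-1) x)\<bar>) (\<lambda>x. x) u) x"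
      unfolding family_add family_weighted_composition[OF bounded_weight_edge_degree[OF a b] bounded_fibres_shift(2)]
        family_weighted_composition[OF wts(1) bounded_fibres_shift(2)]
        family_weighted_composition[OF wts(2) bounded_fibres_shift(2)]
      unfolding case_prod_edge_degree by (rule scaleR_add_left)
  qed
  show ?thesis
    using edge_form_nonneg[OF a shift_inverse(1,2), of u] edge_form_nonneg[OF b shift_inverse(3,4), of u]
    unfolding lattice_op_def split inner_add_left by linarith
qed

text \<open>
  The matrix of the difference operator in the basis of unit vectors. Row \<open>x\<close> of the operator uses
  the edges from \<open>x\<close> to \<open>y\<close> and from \<open>y\<close> to \<open>x\<close>.
\<close>

definition cell_matrix ::
  "(int \<Rightarrow> int \<Rightarrow> real) \<Rightarrow> (int \<Rightarrow> int \<Rightarrow> real) \<Rightarrow> (int \<Rightarrow> int \<Rightarrow> real)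
    \<Rightarrow> int \<times> int \<Rightarrow> int \<times> int \<Rightarrow> real" where
  "cell_matrix a b c x y =
     (if y = shift 1 0 x then case_prod a x else 0) + (if x = shift 1 0 y then case_prod a y else 0)
   + (if y = shift 0 1 x then case_prod b x else 0) + (if x = shift 0 1 y then case_prod b y else 0)
   + (if x = y then case_prod c x else 0)"

lemma cell_matrix_symmetric: "cell_matrix a b c x y = cell_matrix a b c y x"
  by (simp add: cell_matrix_def)

lemma cell_matrix_diagonal: "cell_matrix a b c x x = case_prod c x"
  by (cases x) (simp add: cell_matrix_def)

lemma form_on_cell_matrix_diff:
  assumes "finite I"
  shows "form_on I (cell_matrix a b c') h h - form_on I (cell_matrix a b c) h h
    = (\<Sum>x\<in>I. (case_prod c' x - case_prod c x) * (h x)\<^sup>2)"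
proof -
  have "cell_matrix a b c' x y * h x * h y - cell_matrix a b c x y * h x * h y
      = (if y = x then (case_prod c' x - case_prod c x) * (h x)\<^sup>2 else 0)" for x y
    by (cases x) (auto simp: cell_matrix_def power2_eq_square algebra_simps)
  then show ?thesis
    unfolding form_on_def sum_subtractf[symmetric] using assms by simp
qed

text \<open>
  No edge of nonzero weight leaves \<open>I\<close>, so the operator does not look outside of \<open>I\<close>.
\<close>

lemma difference_op_eq_cell_matrix_sum:
  fixes f :: "int \<times> int \<Rightarrow> complex"
  assumes I: "finite I" and x: "x \<in> I"
    and a: "\<And>y. case_prod a y \<noteq> 0 \<Longrightarrow> y \<in> I \<longleftrightarrow> shift 1 0 y \<in> I"
    and b: "\<And>y. case_prod b y \<noteq> 0 \<Longrightarrow> y \<in> I \<longleftrightarrow> shift 0 1 y \<in> I"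
  shows "difference_op a b c f x = (\<Sum>y\<in>I. cell_matrix a b c x y *\<^sub>R f y)"
proof -
  have delta: "(\<Sum>y\<in>I. (if y = z then s else 0) *\<^sub>R f y) = s *\<^sub>R f z" if "s \<noteq> 0 \<Longrightarrow> z \<in> I" for s z
  proof -
    have "(\<Sum>y\<in>I. (if y = z then s else 0) *\<^sub>R f y) = (\<Sum>y\<in>I. if y = z then s *\<^sub>R f z else 0)"
      by (intro sum.cong) auto
    then show ?thesis using I that by auto
  qed
  have neighbour: "x = shift 1 0 y \<longleftrightarrow> y = shift (-1) 0 x" "x = shift 0 1 y \<longleftrightarrow> y = shift 0 (-1) x" for y
    by (metis shift_inverse)+
  have eq: "cell_matrix a b c x y = (if y = shift 1 0 x then case_prod a x else 0)
     + (if y = shift (-1) 0 x then case_prod a (shift (-1) 0 x) else 0)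
     + (if y = shift 0 1 x then case_prod b x else 0)
     + (if y = shift 0 (-1) x then case_prod b (shift 0 (-1) x) else 0)
     + (if y = x then case_prod c x else 0)" for y
    unfolding cell_matrix_def neighbour by auto
  have "(\<Sum>y\<in>I. cell_matrix a b c x y *\<^sub>R f y)
    = case_prod a x *\<^sub>R f (shift 1 0 x) + case_prod a (shift (-1) 0 x) *\<^sub>R f (shift (-1) 0 x)
    + case_prod b x *\<^sub>R f (shift 0 1 x) + case_prod b (shift 0 (-1) x) *\<^sub>R f (shift 0 (-1) x)
    + case_prod c x *\<^sub>R f x"
    unfolding eq scaleR_add_left sum.distrib
    using a[of x] a[of "shift (-1) 0 x"] b[of x] b[of "shift 0 (-1) x"] x
    by (intro arg_cong2[of _ _ _ _ "(+)"] delta) (simp_all add: shift_inverse)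
  also have "\<dots> = difference_op a b c f x"
    by (cases x) (simp add: difference_op_def scaleR_conv_of_real)
  finally show ?thesis ..
qed

lemma bounded_weight_doubly_periodic:
  fixes w :: "int \<Rightarrow> int \<Rightarrow> real"
  assumes "p1 \<ge> 1" "p2 \<ge> 1" "doubly_periodic p1 p2 w"
  shows "bounded_weight (case_prod w)"
proof -
  let ?J = "{0..<int p1} \<times> {0..<int p2}"
  have "w i k = w (i mod int p1) (k mod int p2)" for i k
    using assms(3)[unfolded doubly_periodic_def, rule_format, of "i mod int p1" "i div int p1" "k mod int p2" "k div int p2"]
    by (simp add: mult.commute)
  moreover have "(i mod int p1, k mod int p2) \<in> ?J" for i k using assms(1,2) by auto
  then have "\<bar>w (i mod int p1) (k mod int p2)\<bar> \<le> (\<Sum>x\<in>?J. \<bar>case_prod w x\<bar>)" for i k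
    using member_le_sum[of "(i mod int p1, k mod int p2)" ?J "\<lambda>x. \<bar>case_prod w x\<bar>"] by auto
  ultimately show ?thesis by (intro bounded_weightI[where K="\<Sum>x\<in>?J. \<bar>case_prod w x\<bar>"]) (auto split: prod.split)
qed

lemma sum_over_period:
  fixes f :: "int \<Rightarrow> real"
  assumes p: "p \<ge> 1" and f: "\<And>i l. f (i + l * int p) = f i"
  shows "(\<Sum>i\<in>{m + 1..m + int p}. f i) = (\<Sum>i = 1..int p. f i)"
proof (rule sum.reindex_bij_witness[where i="\<lambda>j. m + 1 + (j - m - 1) mod int p" and j="\<lambda>i. 1 + (i - 1) mod int p"])
  have bounds: "0 \<le> x mod int p" "x mod int p < int p" for x using p by auto
  fix i assume i: "i \<in> {m + 1..m + int p}"
  have "(1 + (i - 1) mod int p - m - 1) mod int p = ((i - 1) mod int p - m) mod int p" by (simp add: algebra_simps)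
  also have "\<dots> = (i - m - 1) mod int p" by (simp add: mod_diff_left_eq algebra_simps)
  also have "\<dots> = i - m - 1" using i by (intro mod_pos_pos_trivial) auto
  finally show "m + 1 + (1 + (i - 1) mod int p - m - 1) mod int p = i" by simp
  show "1 + (i - 1) mod int p \<in> {1..int p}" using bounds[of "i - 1"] by auto
  have "1 + (i - 1) mod int p = i + (- ((i - 1) div int p)) * int p"
    using div_mult_mod_eq[of "i - 1" "int p"] by (simp add: algebra_simps)
  then show "f (1 + (i - 1) mod int p) = f i" by (simp only: f)
next
  have bounds: "0 \<le> x mod int p" "x mod int p < int p" for x using p by auto
  fix j assume j: "j \<in> {1..int p}"
  have "(m + 1 + (j - m - 1) mod int p - 1) mod int p = (m + (j - m - 1) mod int p) mod int p" by (simp add: algebra_simps)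
  also have "\<dots> = (j - 1) mod int p" by (simp add: mod_add_right_eq algebra_simps)
  also have "\<dots> = j - 1" using j by (intro mod_pos_pos_trivial) auto
  finally show "1 + (m + 1 + (j - m - 1) mod int p - 1) mod int p = j" by simp
  show "m + 1 + (j - m - 1) mod int p \<in> {m + 1..m + int p}" using bounds[of "j - m - 1"] by auto
qed

section \<open>Cutting a periodic operator into cells\<close>

lemma doubly_periodic_shift:
  assumes "doubly_periodic p1 p2 w"
  shows "w (i + s * int p1) (k + t * int p2) = w i k"
    "w (i + s * int p1 - 1) (k + t * int p2) = w (i - 1) k"
    "w (i + s * int p1) (k + t * int p2 - 1) = w i (k - 1)"
  using assms[unfolded doubly_periodic_def, rule_format, of i s k t]
    assms[unfolded doubly_periodic_def, rule_format, of "i - 1" s k t]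
    assms[unfolded doubly_periodic_def, rule_format, of i s "k - 1" t]
  by (simp_all add: algebra_simps)

lemma difference_op_shift_by_periods:
  assumes "doubly_periodic p1 p2 a" "doubly_periodic p1 p2 b" "doubly_periodic p1 p2 c"
  shows "difference_op a b c f (shift (s * int p1) (t * int p2) x)
    = difference_op a b c (\<lambda>y. f (shift (s * int p1) (t * int p2) y)) x"
  by (cases x) (simp add: difference_op_def doubly_periodic_shift[OF assms(1)]
      doubly_periodic_shift[OF assms(2)] doubly_periodic_shift[OF assms(3)] algebra_simps)

lemma tiling_by_periods:
  assumes "p1 \<ge> 1" "p2 \<ge> 1"
  shows "tiling ({m + 1..m + int p1} \<times> {n + 1..n + int p2})
    (\<lambda>(s, t). shift (s * int p1) (t * int p2))
    (\<lambda>(i, k). ((i - m - 1) div int p1, (k - n - 1) div int p2))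
    (\<lambda>(i, k). (m + 1 + (i - m - 1) mod int p1, n + 1 + (k - n - 1) mod int p2))"
proof
  have mod: "0 \<le> x mod int p1" "x mod int p1 < int p1" "0 \<le> x mod int p2" "x mod int p2 < int p2" for x
    using assms by auto
  show "(\<lambda>(i, k). (m + 1 + (i - m - 1) mod int p1, n + 1 + (k - n - 1) mod int p2)) z
      \<in> {m + 1..m + int p1} \<times> {n + 1..n + int p2}" for z
    using mod(1,2)[of "fst z - m - 1"] mod(3,4)[of "snd z - n - 1"] by (cases z) simp
  show "(\<lambda>(s, t). shift (s * int p1) (t * int p2)) ((\<lambda>(i, k). ((i - m - 1) div int p1, (k - n - 1) div int p2)) z)
      ((\<lambda>(i, k). (m + 1 + (i - m - 1) mod int p1, n + 1 + (k - n - 1) mod int p2)) z) = z" for z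
    using div_mult_mod_eq[of "fst z - m - 1" "int p1"] div_mult_mod_eq[of "snd z - n - 1" "int p2"]
    by (cases z) (simp add: algebra_simps)
  fix t :: "int \<times> int" and x assume x: "x \<in> {m + 1..m + int p1} \<times> {n + 1..n + int p2}"
  obtain s' t' i k where t: "t = (s', t')" and x': "x = (i, k)" by (cases t, cases x)
  have eq: "i + s' * int p1 - m - 1 = (i - m - 1) + s' * int p1" "k + t' * int p2 - n - 1 = (k - n - 1) + t' * int p2"
    by simp_all
  have "(i - m - 1) div int p1 = 0" "(k - n - 1) div int p2 = 0"
    using x x' by (auto intro!: div_pos_pos_trivial)
  moreover have "(i - m - 1) mod int p1 = i - m - 1" "(k - n - 1) mod int p2 = k - n - 1"
    using x x' by (auto intro!: mod_pos_pos_trivial)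
  ultimately show "(\<lambda>(i, k). ((i - m - 1) div int p1, (k - n - 1) div int p2))
        ((\<lambda>(s, t). shift (s * int p1) (t * int p2)) t x) = t"
    "(\<lambda>(i, k). (m + 1 + (i - m - 1) mod int p1, n + 1 + (k - n - 1) mod int p2))
        ((\<lambda>(s, t). shift (s * int p1) (t * int p2)) t x) = x"
    using assms unfolding t x' by (simp_all add: eq)
qed simp

text \<open>
  The interval is one period long and starts right after the cut at \<open>m\<close>: the edge layer at the cut is
  met once as the outgoing layer of the last site and once as the incoming layer of the first.
\<close>

lemma sum_cut_layer:
  fixes f :: "int \<Rightarrow> int \<Rightarrow> real"
  assumes p: "p \<ge> 1" and f: "\<And>i l k. f (i + l * int p) k = f i k" and f_off: "\<And>i k. \<not> int p dvd i - m \<Longrightarrow> f i k = 0"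
  shows "(\<Sum>i\<in>{m + 1..m + int p}. f i k) = f m k" "(\<Sum>i\<in>{m + 1..m + int p}. f (i - 1) k) = f m k"
proof -
  have top: "f i k = (if i = m + int p then f m k else 0)" if "i \<in> {m + 1..m + int p}" for i
  proof (cases "int p dvd i - m")
    case True
    then have "int p \<le> i - m" using that by (intro zdvd_imp_le) auto
    then have "i = m + int p" using that by simp
    then show ?thesis using f[of m 1 k] by simp
  qed (use f_off in auto)
  have bottom: "f (i - 1) k = (if i = m + 1 then f m k else 0)" if "i \<in> {m + 1..m + int p}" for i
  proof (cases "int p dvd i - 1 - m")
    case True
    then have "i - 1 - m = 0" using that zdvd_imp_le[of "int p" "i - 1 - m"] by force
    then have "i = m + 1" by simp
    then show ?thesis by simp
  qed (use f_off in auto)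
  show "(\<Sum>i\<in>{m + 1..m + int p}. f i k) = f m k"
    using sum.cong[OF refl top, of "{m + 1..m + int p}"] p by simp
  show "(\<Sum>i\<in>{m + 1..m + int p}. f (i - 1) k) = f m k"
    using sum.cong[OF refl bottom, of "{m + 1..m + int p}"] p by simp
qed

text \<open>
  The operator is cut along the columns congruent to \<open>m\<close> and the rows congruent to \<open>n\<close>. The
  remaining coefficients \<open>a0\<close>, \<open>b0\<close> do not connect different cells; the removed ones \<open>a1\<close>, \<open>b1\<close> are
  compensated by their edge degree \<open>d\<close> on the diagonal, subtracted for a lower and added for an
  upper bound. The traces over a cell differ by twice the sum of \<open>d\<close>, in which each removed edge of
  a cell is counted at both ends.
\<close>

lemma periodic_difference_op_spectrum_bound:
  fixes p1 p2 :: nat and a b c :: "int \<Rightarrow> int \<Rightarrow> real"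
  assumes p: "p1 \<ge> 1" "p2 \<ge> 1"
    and a: "doubly_periodic p1 p2 a" and b: "doubly_periodic p1 p2 b" and c: "doubly_periodic p1 p2 c"
  shows "real_spectrum (difference_op a b c) \<in> lmeasurable \<and>
    measure lebesgue (real_spectrum (difference_op a b c))
      \<le> 4 * ((\<Sum>j = 1..int p1. \<bar>b j n\<bar>) + (\<Sum>k = 1..int p2. \<bar>a m k\<bar>))"
proof -
  define X Y where "X = {m + 1..m + int p1}" and "Y = {n + 1..n + int p2}"
  interpret tiling "X \<times> Y" "\<lambda>(s, t). shift (s * int p1) (t * int p2)"
    "\<lambda>(i, k). ((i - m - 1) div int p1, (k - n - 1) div int p2)"
    "\<lambda>(i, k). (m + 1 + (i - m - 1) mod int p1, n + 1 + (k - n - 1) mod int p2)"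
    unfolding X_def Y_def by (rule tiling_by_periods[OF p])
  define a0 a1 where "a0 i k = (if int p1 dvd i - m then 0 else a i k)"
    and "a1 i k = (if int p1 dvd i - m then a i k else 0)" for i k
  define b0 b1 where "b0 i k = (if int p2 dvd k - n then 0 else b i k)"
    and "b1 i k = (if int p2 dvd k - n then b i k else 0)" for i k
  have dvd: "int q dvd i + s * int q - m \<longleftrightarrow> int q dvd i - m" for q i s m
    using dvd_add_times_triv_right_iff[of "int q" "i - m" s] by (simp add: algebra_simps)
  have per: "doubly_periodic p1 p2 a0" "doubly_periodic p1 p2 a1" "doubly_periodic p1 p2 b0" "doubly_periodic p1 p2 b1"
    using a b unfolding doubly_periodic_def a0_def a1_def b0_def b1_def dvd by auto
  define d where "d = edge_degree a1 b1"
  have per_d: "doubly_periodic p1 p2 d"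
    unfolding doubly_periodic_def d_def edge_degree_def
    by (simp add: doubly_periodic_shift[OF per(2)] doubly_periodic_shift[OF per(4)])
  have per_c: "doubly_periodic p1 p2 (\<lambda>i k. c i k - d i k)" "doubly_periodic p1 p2 (\<lambda>i k. c i k + d i k)"
    using c per_d by (auto simp: doubly_periodic_def)
  note bw = bounded_weight_doubly_periodic[OF p]
  define L where "L = lattice_op a b c"
  have L: "bounded_linear L" unfolding L_def by (intro bounded_linear_lattice_op bw a b c)
  have fL: "difference_op a b c (family u) = family (L u)" for u
    unfolding L_def by (rule family_lattice_op[symmetric]) (intro bw a b c)+
  have block_eq: "lattice_op a0 b0 c' u = block (cell_matrix a0 b0 c') u" if c': "doubly_periodic p1 p2 c'" for c' u
  proof (rule eq_block_if_cellwise)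
    fix t :: "int \<times> int" and x assume x: "x \<in> X \<times> Y"
    have in_X: "i \<in> X \<longleftrightarrow> i + 1 \<in> X" if "\<not> int p1 dvd i - m" for i
    proof -
      have "i \<noteq> m" "i \<noteq> m + int p1" using that by auto
      then show ?thesis unfolding X_def atLeastAtMost_iff by linarith
    qed
    have in_Y: "k \<in> Y \<longleftrightarrow> k + 1 \<in> Y" if "\<not> int p2 dvd k - n" for k
    proof -
      have "k \<noteq> n" "k \<noteq> n + int p2" using that by auto
      then show ?thesis unfolding Y_def atLeastAtMost_iff by linarith
    qed
    have "family (lattice_op a0 b0 c' u) ((case t of (s, t) \<Rightarrow> shift (s * int p1) (t * int p2)) x)
        = difference_op a0 b0 c' (\<lambda>y. family u ((case t of (s, t) \<Rightarrow> shift (s * int p1) (t * int p2)) y)) x"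
      unfolding family_lattice_op[OF bw[OF per(1)] bw[OF per(3)] bw[OF c']]
      by (cases t) (simp add: difference_op_shift_by_periods[OF per(1) per(3) c'])
    also have "\<dots> = (\<Sum>y\<in>X \<times> Y. cell_matrix a0 b0 c' x y *\<^sub>R
        family u ((case t of (s, t) \<Rightarrow> shift (s * int p1) (t * int p2)) y))"
    proof (rule difference_op_eq_cell_matrix_sum[OF finite_I x])
      show "y \<in> X \<times> Y \<longleftrightarrow> shift 1 0 y \<in> X \<times> Y" if "case_prod a0 y \<noteq> 0" for y
        using that in_X[of "fst y"] by (cases y) (simp add: a0_def split: if_splits)
      show "y \<in> X \<times> Y \<longleftrightarrow> shift 0 1 y \<in> X \<times> Y" if "case_prod b0 y \<noteq> 0" for y
        using that in_Y[of "snd y"] by (cases y) (simp add: b0_def split: if_splits)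
    qed
    finally show "family (lattice_op a0 b0 c' u) ((case t of (s, t) \<Rightarrow> shift (s * int p1) (t * int p2)) x)
      = (\<Sum>y\<in>X \<times> Y. cell_matrix a0 b0 c' x y *\<^sub>R
        family u ((case t of (s, t) \<Rightarrow> shift (s * int p1) (t * int p2)) y))" .
  qed
  let ?A = "cell_matrix a0 b0 (\<lambda>i k. c i k - d i k)" and ?B = "cell_matrix a0 b0 (\<lambda>i k. c i k + d i k)"
  have lower: "block ?A u \<bullet> u \<le> L u \<bullet> u" for u
  proof -
    have "L u - lattice_op a0 b0 (\<lambda>i k. c i k - d i k) u = lattice_op a1 b1 d u"
    proof (rule family_eqI)
      fix x
      show "family (L u - lattice_op a0 b0 (\<lambda>i k. c i k - d i k) u) x = family (lattice_op a1 b1 d u) x"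
        unfolding family_diff fL[symmetric] family_lattice_op[OF bw[OF per(1)] bw[OF per(3)] bw[OF per_c(1)]]
          family_lattice_op[OF bw[OF per(2)] bw[OF per(4)] bw[OF per_d]]
        by (cases x) (simp add: difference_op_def a0_def a1_def b0_def b1_def algebra_simps)
    qed
    moreover have "0 \<le> lattice_op a1 b1 d u \<bullet> u"
      unfolding d_def by (intro lattice_op_edge_degree_nonneg bw per)
    ultimately show ?thesis
      unfolding block_eq[OF per_c(1), symmetric] by (metis diff_ge_0_iff_ge inner_diff_left)
  qed
  have upper: "L u \<bullet> u \<le> block ?B u \<bullet> u" for u
  proof -
    \<comment> \<open>the edge degree only sees absolute values, so the sign of the removed edges may be flipped\<close>
    let ?a = "\<lambda>i k. - a1 i k" and ?b = "\<lambda>i k. - b1 i k"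
    have per': "doubly_periodic p1 p2 ?a" "doubly_periodic p1 p2 ?b"
      using per by (auto simp: doubly_periodic_def)
    have d: "d = edge_degree ?a ?b" by (simp add: d_def edge_degree_def fun_eq_iff)
    have "lattice_op a0 b0 (\<lambda>i k. c i k + d i k) u - L u = lattice_op ?a ?b d u"
    proof (rule family_eqI)
      fix x
      show "family (lattice_op a0 b0 (\<lambda>i k. c i k + d i k) u - L u) x = family (lattice_op ?a ?b d u) x"
        unfolding family_diff fL[symmetric] family_lattice_op[OF bw[OF per(1)] bw[OF per(3)] bw[OF per_c(2)]]
          family_lattice_op[OF bw[OF per'(1)] bw[OF per'(2)] bw[OF per_d]]
        by (cases x) (simp add: difference_op_def a0_def a1_def b0_def b1_def algebra_simps)
    qed
    moreover have "0 \<le> lattice_op ?a ?b d u \<bullet> u"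
      unfolding d by (intro lattice_op_edge_degree_nonneg bw per')
    ultimately show ?thesis
      unfolding block_eq[OF per_c(2), symmetric] by (metis diff_ge_0_iff_ge inner_diff_left)
  qed
  have sym: "L u \<bullet> v = u \<bullet> L v" for u v
    unfolding L_def by (intro lattice_op_symmetric bw a b c)
  have d_nonneg: "d i k \<ge> 0" for i k by (simp add: d_def edge_degree_def)
  have AB: "form_on (X \<times> Y) ?A h h \<le> form_on (X \<times> Y) ?B h h" for h
  proof -
    have "0 \<le> form_on (X \<times> Y) ?B h h - form_on (X \<times> Y) ?A h h"
      unfolding form_on_cell_matrix_diff[OF finite_I] using d_nonneg by (intro sum_nonneg) auto
    then show ?thesis by simp
  qed
  have "(\<Sum>x\<in>X \<times> Y. ?B x x - ?A x x) = (\<Sum>x\<in>X \<times> Y. 2 * case_prod d x)"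
    by (intro sum.cong) (auto simp: cell_matrix_diagonal)
  also have "\<dots> = 2 * (\<Sum>i\<in>X. \<Sum>k\<in>Y. d i k)"
    by (simp add: sum_distrib_left sum.cartesian_product case_prod_unfold)
  also have "(\<Sum>i\<in>X. \<Sum>k\<in>Y. d i k) = (\<Sum>k\<in>Y. (\<Sum>i\<in>X. \<bar>a1 i k\<bar>) + (\<Sum>i\<in>X. \<bar>a1 (i - 1) k\<bar>))
      + (\<Sum>i\<in>X. (\<Sum>k\<in>Y. \<bar>b1 i k\<bar>) + (\<Sum>k\<in>Y. \<bar>b1 i (k - 1)\<bar>))"
    unfolding d_def edge_degree_def sum.distrib by (simp add: sum.swap[of _ X Y])
  also have "(\<Sum>k\<in>Y. (\<Sum>i\<in>X. \<bar>a1 i k\<bar>) + (\<Sum>i\<in>X. \<bar>a1 (i - 1) k\<bar>)) = (\<Sum>k\<in>Y. 2 * \<bar>a m k\<bar>)"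
  proof (intro sum.cong refl)
    fix k
    have per_a1: "\<bar>a1 (i + l * int p1) k\<bar> = \<bar>a1 i k\<bar>" for i l k
      using doubly_periodic_shift(1)[OF per(2), of i l k 0] by simp
    show "(\<Sum>i\<in>X. \<bar>a1 i k\<bar>) + (\<Sum>i\<in>X. \<bar>a1 (i - 1) k\<bar>) = 2 * \<bar>a m k\<bar>"
      using sum_cut_layer[OF p(1), of "\<lambda>i k. \<bar>a1 i k\<bar>" m k, OF per_a1]
      by (simp add: X_def a1_def)
  qed
  also have "(\<Sum>i\<in>X. (\<Sum>k\<in>Y. \<bar>b1 i k\<bar>) + (\<Sum>k\<in>Y. \<bar>b1 i (k - 1)\<bar>)) = (\<Sum>i\<in>X. 2 * \<bar>b i n\<bar>)"
  proof (intro sum.cong refl)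
    fix i
    have per_b1: "\<bar>b1 i (k + l * int p2)\<bar> = \<bar>b1 i k\<bar>" for i l k
      using doubly_periodic_shift(1)[OF per(4), of i 0 k l] by simp
    show "(\<Sum>k\<in>Y. \<bar>b1 i k\<bar>) + (\<Sum>k\<in>Y. \<bar>b1 i (k - 1)\<bar>) = 2 * \<bar>b i n\<bar>"
      using sum_cut_layer[OF p(2), of "\<lambda>k i. \<bar>b1 i k\<bar>" n i, OF per_b1]
      by (simp add: Y_def b1_def)
  qed
  also have "(\<Sum>k\<in>Y. 2 * \<bar>a m k\<bar>) = 2 * (\<Sum>k = 1..int p2. \<bar>a m k\<bar>)"
  proof -
    have "\<bar>a m (k + l * int p2)\<bar> = \<bar>a m k\<bar>" for k l
      using doubly_periodic_shift(1)[OF a, of m 0 k l] by simp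
    from sum_over_period[OF p(2), of "\<lambda>k. \<bar>a m k\<bar>" n, OF this]
    show ?thesis by (simp add: Y_def sum_distrib_left[symmetric])
  qed
  also have "(\<Sum>i\<in>X. 2 * \<bar>b i n\<bar>) = 2 * (\<Sum>j = 1..int p1. \<bar>b j n\<bar>)"
  proof -
    have "\<bar>b (i + l * int p1) n\<bar> = \<bar>b i n\<bar>" for i l
      using doubly_periodic_shift(1)[OF b, of i l n 0] by simp
    from sum_over_period[OF p(1), of "\<lambda>i. \<bar>b i n\<bar>" m, OF this]
    show ?thesis by (simp add: X_def sum_distrib_left[symmetric])
  qed
  finally have trace: "(\<Sum>x\<in>X \<times> Y. ?B x x - ?A x x)
      = 4 * ((\<Sum>j = 1..int p1. \<bar>b j n\<bar>) + (\<Sum>k = 1..int p2. \<bar>a m k\<bar>))" by simp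
  have "real_spectrum (difference_op a b c) = {l. \<not> boundedly_invertible (\<lambda>u. L u - l *\<^sub>R u)}"
    by (rule real_spectrum_eq_not_boundedly_invertible) (use L fL in \<open>simp_all add: bounded_linear.linear\<close>)
  moreover have "{l. \<not> boundedly_invertible (\<lambda>u. L u - l *\<^sub>R u)} \<in> lmeasurable \<and>
      measure lebesgue {l. \<not> boundedly_invertible (\<lambda>u. L u - l *\<^sub>R u)} \<le> (\<Sum>x\<in>X \<times> Y. ?B x x - ?A x x)"
    by (rule spectrum_measure_le_trace[OF L sym _ _ AB lower upper]) (simp_all add: cell_matrix_symmetric)
  ultimately show ?thesis unfolding trace by simp
qed

theorem corollary1p2:
  fixes p1 p2 :: nat and a b c :: "int \<Rightarrow> int \<Rightarrow> real"
  assumes "p1 \<ge> 1" and "p2 \<ge> 1"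
    and "doubly_periodic p1 p2 a" and "doubly_periodic p1 p2 b" and "doubly_periodic p1 p2 c"
  shows "(real_spectrum (difference_op a b c) \<in> lmeasurable \<and>
          1 / 4 * measure lebesgue (real_spectrum (difference_op a b c))
            \<le> Min (range (\<lambda>n::int. \<Sum>j = 1..int p1. \<bar>b j n\<bar>))
              + Min (range (\<lambda>m::int. \<Sum>k = 1..int p2. \<bar>a m k\<bar>))) \<and>
         (real_spectrum (schroedinger_op c) \<in> lmeasurable \<and>
          measure lebesgue (real_spectrum (schroedinger_op c)) \<le> 4 * (real p1 + real p2))"
proof -
  have "finite (range (\<lambda>n::int. \<Sum>j = 1..int p1. \<bar>b j n\<bar>))"
    using assms by (intro finite_range_row_sums[where ?p2.0=p2]) auto
  from Min_in[OF this] obtain n where n: "Min (range (\<lambda>n::int. \<Sum>j = 1..int p1. \<bar>b j n\<bar>)) = (\<Sum>j = 1..int p1. \<bar>b j n\<bar>)"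
    by auto
  have "finite (range (\<lambda>m::int. \<Sum>k = 1..int p2. \<bar>a m k\<bar>))"
    using assms by (intro finite_range_column_sums[where ?p1.0=p1]) auto
  from Min_in[OF this] obtain m where m: "Min (range (\<lambda>m::int. \<Sum>k = 1..int p2. \<bar>a m k\<bar>)) = (\<Sum>k = 1..int p2. \<bar>a m k\<bar>)"
    by auto
  have one: "doubly_periodic p1 p2 (\<lambda>_ _. 1 :: real)" by (simp add: doubly_periodic_def)
  have H: "schroedinger_op c = difference_op (\<lambda>_ _. 1) (\<lambda>_ _. 1) c"
    by (simp add: schroedinger_op_def difference_op_def fun_eq_iff)
  show ?thesis
    using periodic_difference_op_spectrum_bound[where n=n and m=m, OF assms]
      periodic_difference_op_spectrum_bound[where n=0 and m=0, OF assms(1,2) one one assms(5)]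
    unfolding n m H by (simp add: add.commute)
qed

end
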